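(* Let $\Theta_1,\Theta_2$ be minimal L-systems (input-output space $\mathbb C$, $J=1$) with main operators $T_1,T_2$, both satisfying Hypothesis I, and let $\Theta=\Theta_1\cdot\Theta_2$ be their coupling. Then for $z\in\rho(T_1)\cap\rho(T_2)$, $$W_\Theta(z)=W_{\Theta_1}(z)\cdot W_{\Theta_2}(z).$$
   Context: L-systems. Let $\dot A$ be a closed, densely defined symmetric operator with deficiency indices $(1,1)$ in a Hilbert space $\mathcal H$. Let $\mathcal H_+=\mathrm{Dom}(\dot A^* )$ with inner product $(f,g)_+=(f,g)+(\dot A^*f,\dot A^*g)$, and let $\mathcal H_+\subset\mathcal H\subset\mathcal H_-$ be the associated rigged Hilbert space ($\mathcal H_-$ is the dual of $\mathcal H_+$ with respect to the pairing extending the inner product of $\mathcal H$). For a bounded $\mathbb A:\mathcal H_+\to\mathcal H_-$ the adjoint $\mathbb A^*$ is again bounded $\mathcal H_+\to\mathcal H_-$; $\mathrm{Re}\,\mathbb A=(\mathbb A+\mathbb A^* )/2$, $\mathrm{Im}\,\mathbb A=(\mathbb A-\mathbb A^* )/(2i)$. An operator $T$ with $\dot A\subset T\subset\dot A^*$ belongs to $\Lambda(\dot A)$ if $\rho(T)\neq\emptyset$ and $\mathrm{Dom}(\dot A)=\mathrm{Dom}(T)\cap\mathrm{Dom}(T^* )$. A bounded $\mathbb A:\mathcal H_+\to\mathcal H_-$ is a $( * )$-extension of $T$ if $\mathbb A\supset T\supset\dot A$, $\mathbb A^*\supset T^*\supset\dot A$, and the quasi-kernel $\hat A$ of $\mathrm{Re}\,\mathbb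 A$ (the restriction of $\mathrm{Re}\,\mathbb A$ to $\{f\in\mathcal H_+:\mathrm{Re}\,\mathbb A f\in\mathcal H\}$) is self-adjoint in $\mathcal H$. An L-system is an array $\Theta=\begin{pmatrix}\mathbb A&K&1\\ \mathcal H_+\subset\mathcal H\subset\mathcal H_-&&\mathbb C\end{pmatrix}$, where $\mathbb A$ is a $( * )$-extension of some $T\in\Lambda(\dot A)$ (the main operator), $K:\mathbb C\to\mathcal H_-$ is bounded with adjoint $K^*:\mathcal H_+\to\mathbb C$, $\mathrm{Im}\,\mathbb A=KK^*$, $\mathrm{Ran}(K)=\mathrm{Ran}(\mathrm{Im}\,\mathbb A)$. It is minimal if $\dot A$ is prime (no nontrivial reducing subspace on which $\dot A$ induces a self-adjoint operator). Transfer function: $W_\Theta(z)=1-2iK^*(\mathbb A-zI)^{-1}K$, $z\in\rho(T)$ (well defined). Hypothesis I for an L-system: there are $g_\pm\in\ker(\dot A^*\mp iI)$, $\|g_\pm\|=1$, with $g_+-g_-\in\mathrm{Dom}(\hat A)$ and $g_+-\kappa g_-\in\mathrm{Dom}(T)$ for some $0\le\kappa<1$ ($T\neq T^*$ is then a maximal dissipative extension of $\dot A$). The number $\kappa$ is the von Neumann parameter of $T$. Coupling. For $k=1,2$ let $\Theta_k$ act in $\mathcal H_k$, with symmetric operator $\dot A_k$, main operator $T_k$, and $g^k_\pm,\kappa_k$ as in Hypothesis I. Define $\alpha\in(0,\pi/2]$ by $\tan\alpha=\frac1{\kappa_2}\sqrt{\frac{1-\kappa_2^2}{1-\kappa_1^2}}$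 if $\kappa_2\ne0$ and $\alpha=\pi/2$ if $\kappa_2=0$; define $\beta$ by $\sin\beta=\kappa_1\sin\alpha$, $\cos\beta=\frac1{\kappa_2}\cos\alpha$ if $\kappa_2\neq0$, and $\sin\beta=\kappa_1$, $\cos\beta=\sqrt{1-\kappa_1^2}$ if $\kappa_2=0$. Let $\dot A$ be the restriction of $(\dot A_1\oplus\dot A_2)^*$ to $\mathrm{Dom}(\dot A_1\oplus\dot A_2)\dot+\mathcal L_0$, where $\mathcal L_0$ is spanned by $\sin\alpha\,(g_+^1-\kappa_1g_-^1)\oplus\cos\alpha\,(g_+^2-\frac1{\kappa_2}g_-^2)$ if $\kappa_2\ne0$, and by $(g_+^1-\kappa_1g_-^1)\oplus(-\sqrt{1-\kappa_1^2}\,g_-^2)$ if $\kappa_2=0$. Then $\dot A$ is symmetric with deficiency indices $(1,1)$ in $\mathcal H_1\oplus\mathcal H_2$, with normalized deficiency vectors $G_+=\cos\alpha\,g_+^1-\sin\alpha\,g_+^2\in\ker(\dot A^*-iI)$ and $G_-=\cos\beta\,g_-^1-\sin\beta\,g_-^2\in\ker(\dot A^*+iI)$. The operator coupling $T=T_1\uplus T_2$ is the restriction of $(\dot A_1\oplus\dot A_2)^*$ to $\mathrm{Dom}(\dot A)\dot+\mathrm{span}\{G_+-\kappa_1\kappa_2G_-\}$, a maximal dissipative extension of $\dot A$ with von Neumann parameter $\kappa_1\kappa_2$. The coupling $\Theta=\Theta_1\cdot\Theta_2$ is the L-system with symmetric operator $\dot A$, main operator $T$, rigging $\mathcal H_+=\mathrm{Dom}(\dot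 A^* )\subset\mathcal H_1\oplus\mathcal H_2\subset\mathcal H_-$, state-space operator $\mathbb A$ the (unique) $( * )$-extension of $T$ such that the quasi-kernel of $\mathrm{Re}\,\mathbb A$ is the self-adjoint extension $\hat A$ of $\dot A$ with $G_+-G_-\in\mathrm{Dom}(\hat A)$, and $Kc=c\chi$ with $\mathrm{Im}\,\mathbb A=(\cdot,\chi)\chi$ ($\chi$ is determined up to a unimodular factor). *)

theory Defs
  imports "HOL-Analysis.Analysis"
begin

section \<open>Complex Hilbert spaces\<close>

text \<open>The inner product is linear in its first argument. The complex structure extends the
  real one, so norm and topology are those of the library.\<close>

class complex_hilbert = banach +
  fixes scaleC :: "complex \<Rightarrow> 'a \<Rightarrow> 'a" (infixr "*\<^sub>C" 75)
    and cinner :: "'a \<Rightarrow> 'a \<Rightarrow> complex"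
  assumes scaleC_add_right: "c *\<^sub>C (x + y) = c *\<^sub>C x + c *\<^sub>C y"
    and scaleC_add_left: "(c + d) *\<^sub>C x = c *\<^sub>C x + d *\<^sub>C x"
    and scaleC_scaleC: "c *\<^sub>C d *\<^sub>C x = (c * d) *\<^sub>C x"
    and scaleR_scaleC: "r *\<^sub>R x = complex_of_real r *\<^sub>C x"
    and cinner_commute: "cinner x y = cnj (cinner y x)"
    and cinner_add_left: "cinner (x + y) w = cinner x w + cinner y w"
    and cinner_scaleC_left: "cinner (c *\<^sub>C x) y = c * cinner x y"
    and cinner_self: "cinner x x = complex_of_real ((norm x)\<^sup>2)"

global_interpretation complex_vector:
  vector_space "scaleC :: complex \<Rightarrow> 'a \<Rightarrow> 'a::complex_hilbert"
proof
  show "1 *\<^sub>C x = x" for x :: 'a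
    using scaleR_scaleC[of 1 x] by simp
qed (simp_all add: scaleC_add_right scaleC_add_left scaleC_scaleC)

text \<open>The orthogonal sum of two Hilbert spaces is carried by their product type.\<close>

instantiation prod :: (complex_hilbert, complex_hilbert) complex_hilbert
begin

definition scaleC_prod :: "complex \<Rightarrow> 'a \<times> 'b \<Rightarrow> 'a \<times> 'b" where
  "scaleC_prod c x = (c *\<^sub>C fst x, c *\<^sub>C snd x)"

definition cinner_prod :: "'a \<times> 'b \<Rightarrow> 'a \<times> 'b \<Rightarrow> complex" where
  "cinner_prod x y = cinner (fst x) (fst y) + cinner (snd x) (snd y)"

instance
proof
  show "cinner x y = cnj (cinner y x)" for x y :: "'a \<times> 'b"
    by (simp add: cinner_prod_def
        cinner_commute[of "fst x" "fst y"] cinner_commute[of "snd x" "snd y"])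
qed (simp_all add: scaleC_prod_def cinner_prod_def scaleC_add_right scaleC_add_left
    scaleC_scaleC scaleR_scaleC scaleR_prod_def cinner_add_left cinner_scaleC_left
    cinner_self norm_prod_def distrib_left)

end


section \<open>Unbounded operators\<close>

text \<open>An operator is given by its graph; \<open>S\<close> extends \<open>T\<close> iff \<open>T \<subseteq> S\<close>, and closedness of
  an operator is closedness of its graph.\<close>

type_synonym 'a operator = "('a \<times> 'a) set"

definition linear_operator :: "'a::complex_hilbert operator \<Rightarrow> bool" where
  "linear_operator T \<longleftrightarrow> complex_vector.subspace T \<and> single_valued T"

definition op_app :: "'a operator \<Rightarrow> 'a \<Rightarrow> 'a" where
  "op_app T f = (THE g. (f, g) \<in> T)"

definition op_restrict :: "'a operator \<Rightarrow> 'a set \<Rightarrow> 'a operator" where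
  "op_restrict T D = {(f, g) \<in> T. f \<in> D}"

definition op_adjoint :: "'a::complex_hilbert operator \<Rightarrow> 'a operator" where
  "op_adjoint T = {(g, h). \<forall>(f, w) \<in> T. cinner w g = cinner f h}"

definition densely_defined :: "'a::complex_hilbert operator \<Rightarrow> bool" where
  "densely_defined T \<longleftrightarrow> closure (Domain T) = UNIV"

definition self_adjoint :: "'a::complex_hilbert operator \<Rightarrow> bool" where
  "self_adjoint T \<longleftrightarrow> linear_operator T \<and> densely_defined T \<and> op_adjoint T = T"

definition op_ker :: "'a::complex_hilbert operator \<Rightarrow> complex \<Rightarrow> 'a set" where
  "op_ker T z = {f. (f, z *\<^sub>C f) \<in> T}"

text \<open>\<open>z\<close> belongs to the resolvent set iff the inverse of the graph of \<open>T - z I\<close> is the graph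
  of a bounded everywhere defined operator.\<close>

definition resolvent_set :: "'a::complex_hilbert operator \<Rightarrow> complex set" where
  "resolvent_set T =
     {z. \<exists>R. bounded_linear R \<and>
        {(g - z *\<^sub>C f, f) | f g. (f, g) \<in> T} = {(h, R h) | h. True}}"

definition symmetric_operator_11 :: "'a::complex_hilbert operator \<Rightarrow> bool" where
  "symmetric_operator_11 A \<longleftrightarrow>
     linear_operator A \<and> closed A \<and> densely_defined A \<and> A \<subseteq> op_adjoint A \<and>
     complex_vector.dim (op_ker (op_adjoint A) \<i>) = 1 \<and>
     complex_vector.dim (op_ker (op_adjoint A) (- \<i>)) = 1"

definition orth_compl :: "'a::complex_hilbert set \<Rightarrow> 'a set" where
  "orth_compl M = {f. \<forall>g \<in> M. cinner f g = 0}"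

definition reduces :: "'a::complex_hilbert set \<Rightarrow> 'a operator \<Rightarrow> bool" where
  "reduces M A \<longleftrightarrow> complex_vector.subspace M \<and> closed M \<and>
     (\<forall>(f, g) \<in> A. \<exists>f1 f2 g1 g2. f = f1 + f2 \<and> g = g1 + g2 \<and>
        (f1, g1) \<in> A \<inter> M \<times> M \<and>
        (f2, g2) \<in> A \<inter> orth_compl M \<times> orth_compl M)"

text \<open>The part of \<open>A\<close> in \<open>M\<close> is \<open>A \<inter> M \<times> M\<close>; its adjoint as an operator in the Hilbert
  space \<open>M\<close> is the intersection of its adjoint relation in the whole space with \<open>M \<times> M\<close>.\<close>

definition prime_operator :: "'a::complex_hilbert operator \<Rightarrow> bool" where
  "prime_operator A \<longleftrightarrow>
     \<not> (\<exists>M. reduces M A \<and> M \<noteq> {0} \<and>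
           M \<subseteq> closure (Domain (A \<inter> M \<times> M)) \<and>
           op_adjoint (A \<inter> M \<times> M) \<inter> M \<times> M = A \<inter> M \<times> M)"

definition class_Lambda :: "'a::complex_hilbert operator \<Rightarrow> 'a operator set" where
  "class_Lambda A =
     {T. linear_operator T \<and> A \<subseteq> T \<and> T \<subseteq> op_adjoint A \<and> resolvent_set T \<noteq> {} \<and>
         Domain A = Domain T \<inter> Domain (op_adjoint T)}"


section \<open>The rigged Hilbert space of a symmetric operator\<close>

definition Hplus :: "'a::complex_hilbert operator \<Rightarrow> 'a set" where
  "Hplus A = Domain (op_adjoint A)"

definition plus_inner :: "'a::complex_hilbert operator \<Rightarrow> 'a \<Rightarrow> 'a \<Rightarrow> complex" where
  "plus_inner A f g =
     cinner f g + cinner (op_app (op_adjoint A) f) (op_app (op_adjoint A) g)"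

definition plus_norm :: "'a::complex_hilbert operator \<Rightarrow> 'a \<Rightarrow> real" where
  "plus_norm A f = sqrt (Re (plus_inner A f f))"

text \<open>An element \<open>\<phi>\<close> of \<open>H\<^sub>-\<close> is the bounded antilinear functional \<open>g \<mapsto> (\<phi>, g)\<close> on \<open>H\<^sub>+\<close>.
  Functionals are set to \<open>0\<close> off \<open>H\<^sub>+\<close>, so that equality in \<open>H\<^sub>-\<close> is equality of functions.\<close>

definition Hminus :: "'a::complex_hilbert operator \<Rightarrow> ('a \<Rightarrow> complex) set" where
  "Hminus A =
     {\<phi>. (\<forall>f \<in> Hplus A. \<forall>g \<in> Hplus A. \<phi> (f + g) = \<phi> f + \<phi> g) \<and>
         (\<forall>c. \<forall>g \<in> Hplus A. \<phi> (c *\<^sub>C g) = cnj c * \<phi> g) \<and>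
         (\<exists>C. \<forall>g \<in> Hplus A. cmod (\<phi> g) \<le> C * plus_norm A g) \<and>
         (\<forall>g. g \<notin> Hplus A \<longrightarrow> \<phi> g = 0)}"

definition minus_norm :: "'a::complex_hilbert operator \<Rightarrow> ('a \<Rightarrow> complex) \<Rightarrow> real" where
  "minus_norm A \<phi> = (SUP g \<in> {g \<in> Hplus A. plus_norm A g \<le> 1}. cmod (\<phi> g))"

text \<open>The embedding of \<open>H\<close> into \<open>H\<^sub>-\<close>.\<close>

definition emb :: "'a::complex_hilbert operator \<Rightarrow> 'a \<Rightarrow> ('a \<Rightarrow> complex)" where
  "emb A f = (\<lambda>g. if g \<in> Hplus A then cinner f g else 0)"

text \<open>Operators \<open>H\<^sub>+ \<rightarrow> H\<^sub>-\<close> are functions of type \<^typ>\<open>'a \<Rightarrow> ('a \<Rightarrow> complex)\<close>, with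
  \<open>B f g\<close> the pairing \<open>(B f, g)\<close>; their values at \<open>f \<notin> H\<^sub>+\<close> are irrelevant.\<close>

definition bounded_rig ::
    "'a::complex_hilbert operator \<Rightarrow> ('a \<Rightarrow> 'a \<Rightarrow> complex) \<Rightarrow> bool" where
  "bounded_rig A B \<longleftrightarrow>
     (\<forall>f \<in> Hplus A. B f \<in> Hminus A) \<and>
     (\<forall>f1 \<in> Hplus A. \<forall>f2 \<in> Hplus A. B (f1 + f2) = (\<lambda>g. B f1 g + B f2 g)) \<and>
     (\<forall>c. \<forall>f \<in> Hplus A. B (c *\<^sub>C f) = (\<lambda>g. c * B f g)) \<and>
     (\<exists>C. \<forall>f \<in> Hplus A. minus_norm A (B f) \<le> C * plus_norm A f)"

text \<open>The adjoint is given by \<open>(B\<^sup>* f, g) = (f, B g)\<close>, the conjugate of \<open>(B g, f)\<close>.\<close>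

definition rig_adjoint ::
    "'a::complex_hilbert operator \<Rightarrow> ('a \<Rightarrow> 'a \<Rightarrow> complex) \<Rightarrow> ('a \<Rightarrow> 'a \<Rightarrow> complex)" where
  "rig_adjoint A B f = (\<lambda>g. if g \<in> Hplus A then cnj (B g f) else 0)"

definition rig_Re ::
    "'a::complex_hilbert operator \<Rightarrow> ('a \<Rightarrow> 'a \<Rightarrow> complex) \<Rightarrow> ('a \<Rightarrow> 'a \<Rightarrow> complex)" where
  "rig_Re A B f = (\<lambda>g. (B f g + rig_adjoint A B f g) / 2)"

definition rig_Im ::
    "'a::complex_hilbert operator \<Rightarrow> ('a \<Rightarrow> 'a \<Rightarrow> complex) \<Rightarrow> ('a \<Rightarrow> 'a \<Rightarrow> complex)" where
  "rig_Im A B f = (\<lambda>g. (B f g - rig_adjoint A B f g) / (2 * \<i>))"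

definition rig_extends ::
    "'a::complex_hilbert operator \<Rightarrow> ('a \<Rightarrow> 'a \<Rightarrow> complex) \<Rightarrow> 'a operator \<Rightarrow> bool" where
  "rig_extends A B T \<longleftrightarrow> (\<forall>(f, g) \<in> T. f \<in> Hplus A \<and> B f = emb A g)"

definition quasi_kernel ::
    "'a::complex_hilbert operator \<Rightarrow> ('a \<Rightarrow> 'a \<Rightarrow> complex) \<Rightarrow> 'a operator" where
  "quasi_kernel A B = {(f, g). f \<in> Hplus A \<and> B f = emb A g}"

definition star_extension ::
    "'a::complex_hilbert operator \<Rightarrow> 'a operator \<Rightarrow> ('a \<Rightarrow> 'a \<Rightarrow> complex) \<Rightarrow> bool" where
  "star_extension A T B \<longleftrightarrow> bounded_rig A B \<and>
     rig_extends A B T \<and> A \<subseteq> T \<and>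
     rig_extends A (rig_adjoint A B) (op_adjoint T) \<and> A \<subseteq> op_adjoint T \<and>
     self_adjoint (quasi_kernel A (rig_Re A B))"

definition bounded_chan ::
    "'a::complex_hilbert operator \<Rightarrow> (complex \<Rightarrow> 'a \<Rightarrow> complex) \<Rightarrow> bool" where
  "bounded_chan A K \<longleftrightarrow>
     (\<forall>c. K c \<in> Hminus A) \<and>
     (\<forall>c d. K (c + d) = (\<lambda>g. K c g + K d g)) \<and>
     (\<forall>c d. K (c * d) = (\<lambda>g. c * K d g)) \<and>
     (\<exists>C. \<forall>c. minus_norm A (K c) \<le> C * cmod c)"

definition chan_adjoint :: "(complex \<Rightarrow> 'a \<Rightarrow> complex) \<Rightarrow> 'a \<Rightarrow> complex" where
  "chan_adjoint K f = cnj (K 1 f)"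

text \<open>The defining property \<open>(K c, f) = (c, K\<^sup>* f)\<close> of the adjoint.\<close>

lemma chan_adjoint:
  assumes "bounded_chan A K"
  shows "K c f = c * cnj (chan_adjoint K f)"
proof -
  have "K (c * 1) = (\<lambda>g. c * K 1 g)"
    using assms unfolding bounded_chan_def by blast
  then show ?thesis by (simp add: chan_adjoint_def)
qed


section \<open>L-systems\<close>

text \<open>The input-output space is \<open>\<complex>\<close> with \<open>J = 1\<close>.\<close>

record 'a lsystem =
  symm_op :: "'a operator"
  main_op :: "'a operator"
  state_op :: "'a \<Rightarrow> 'a \<Rightarrow> complex"
  chan_op :: "complex \<Rightarrow> 'a \<Rightarrow> complex"

definition L_system :: "'a::complex_hilbert lsystem \<Rightarrow> bool" where
  "L_system \<Theta> \<longleftrightarrow>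
     symmetric_operator_11 (symm_op \<Theta>) \<and>
     main_op \<Theta> \<in> class_Lambda (symm_op \<Theta>) \<and>
     star_extension (symm_op \<Theta>) (main_op \<Theta>) (state_op \<Theta>) \<and>
     bounded_chan (symm_op \<Theta>) (chan_op \<Theta>) \<and>
     (\<forall>f \<in> Hplus (symm_op \<Theta>).
        rig_Im (symm_op \<Theta>) (state_op \<Theta>) f = chan_op \<Theta> (chan_adjoint (chan_op \<Theta>) f)) \<and>
     range (chan_op \<Theta>) = rig_Im (symm_op \<Theta>) (state_op \<Theta>) ` Hplus (symm_op \<Theta>)"

definition minimal_lsystem :: "'a::complex_hilbert lsystem \<Rightarrow> bool" where
  "minimal_lsystem \<Theta> \<longleftrightarrow> prime_operator (symm_op \<Theta>)"

definition real_quasi_kernel :: "'a::complex_hilbert lsystem \<Rightarrow> 'a operator" where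
  "real_quasi_kernel \<Theta> = quasi_kernel (symm_op \<Theta>) (rig_Re (symm_op \<Theta>) (state_op \<Theta>))"

text \<open>\<open>\<bbbA> - z I\<close> as an operator \<open>H\<^sub>+ \<rightarrow> H\<^sub>-\<close>.\<close>

definition state_shift :: "'a::complex_hilbert lsystem \<Rightarrow> complex \<Rightarrow> 'a \<Rightarrow> 'a \<Rightarrow> complex" where
  "state_shift \<Theta> z f = (\<lambda>g. state_op \<Theta> f g - z * emb (symm_op \<Theta>) f g)"

definition transfer_function :: "'a::complex_hilbert lsystem \<Rightarrow> complex \<Rightarrow> complex" where
  "transfer_function \<Theta> z =
     1 - 2 * \<i> * chan_adjoint (chan_op \<Theta>)
       (inv_into (Hplus (symm_op \<Theta>)) (state_shift \<Theta> z) (chan_op \<Theta> 1))"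

definition hypothesis_I ::
    "'a::complex_hilbert lsystem \<Rightarrow> 'a \<Rightarrow> 'a \<Rightarrow> real \<Rightarrow> bool" where
  "hypothesis_I \<Theta> gp gm \<kappa> \<longleftrightarrow>
     gp \<in> op_ker (op_adjoint (symm_op \<Theta>)) \<i> \<and> norm gp = 1 \<and>
     gm \<in> op_ker (op_adjoint (symm_op \<Theta>)) (- \<i>) \<and> norm gm = 1 \<and>
     0 \<le> \<kappa> \<and> \<kappa> < 1 \<and>
     gp - gm \<in> Domain (real_quasi_kernel \<Theta>) \<and>
     gp - complex_of_real \<kappa> *\<^sub>C gm \<in> Domain (main_op \<Theta>)"


section \<open>Coupling\<close>

definition op_sum ::
    "'a operator \<Rightarrow> 'b operator \<Rightarrow> ('a \<times> 'b) operator" where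
  "op_sum A1 A2 = {((f1, f2), (h1, h2)) | f1 f2 h1 h2. (f1, h1) \<in> A1 \<and> (f2, h2) \<in> A2}"

definition coupling_angles :: "real \<Rightarrow> real \<Rightarrow> real \<Rightarrow> real \<Rightarrow> bool" where
  "coupling_angles \<kappa>1 \<kappa>2 \<alpha> \<beta> \<longleftrightarrow> 0 < \<alpha> \<and> \<alpha> \<le> pi / 2 \<and>
     (if \<kappa>2 \<noteq> 0
      then tan \<alpha> = 1 / \<kappa>2 * sqrt ((1 - \<kappa>2\<^sup>2) / (1 - \<kappa>1\<^sup>2)) \<and>
           sin \<beta> = \<kappa>1 * sin \<alpha> \<and> cos \<beta> = 1 / \<kappa>2 * cos \<alpha>
      else \<alpha> = pi / 2 \<and> sin \<beta> = \<kappa>1 \<and> cos \<beta> = sqrt (1 - \<kappa>1\<^sup>2))"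

text \<open>The vector spanning \<open>\<L>\<^sub>0\<close>.\<close>

definition coupling_vector ::
    "'a::complex_hilbert \<Rightarrow> 'a \<Rightarrow> real \<Rightarrow> 'b::complex_hilbert \<Rightarrow> 'b \<Rightarrow> real \<Rightarrow> real \<Rightarrow> 'a \<times> 'b"
where
  "coupling_vector gp1 gm1 \<kappa>1 gp2 gm2 \<kappa>2 \<alpha> =
     (if \<kappa>2 \<noteq> 0
      then (complex_of_real (sin \<alpha>) *\<^sub>C (gp1 - complex_of_real \<kappa>1 *\<^sub>C gm1),
            complex_of_real (cos \<alpha>) *\<^sub>C (gp2 - complex_of_real (1 / \<kappa>2) *\<^sub>C gm2))
      else (gp1 - complex_of_real \<kappa>1 *\<^sub>C gm1,
            complex_of_real (- sqrt (1 - \<kappa>1\<^sup>2)) *\<^sub>C gm2))"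

text \<open>With the angle \<open>\<alpha>\<close> this gives \<open>G\<^sub>+\<close> from the \<open>g\<^sub>+\<close>, with \<open>\<beta>\<close> it gives \<open>G\<^sub>-\<close> from
  the \<open>g\<^sub>-\<close>.\<close>

definition coupling_deficiency ::
    "real \<Rightarrow> 'a::complex_hilbert \<Rightarrow> 'b::complex_hilbert \<Rightarrow> 'a \<times> 'b" where
  "coupling_deficiency t g1 g2 =
     (complex_of_real (cos t) *\<^sub>C g1, - (complex_of_real (sin t) *\<^sub>C g2))"

definition coupling_symm_op ::
    "'a::complex_hilbert operator \<Rightarrow> 'b::complex_hilbert operator \<Rightarrow> 'a \<times> 'b \<Rightarrow>
     ('a \<times> 'b) operator" where
  "coupling_symm_op A1 A2 v =
     op_restrict (op_adjoint (op_sum A1 A2))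
       {d + l | d l. d \<in> Domain (op_sum A1 A2) \<and> l \<in> complex_vector.span {v}}"

definition coupling_main_op ::
    "'a::complex_hilbert operator \<Rightarrow> 'b::complex_hilbert operator \<Rightarrow> 'a \<times> 'b \<Rightarrow>
     'a \<times> 'b \<Rightarrow> ('a \<times> 'b) operator" where
  "coupling_main_op A1 A2 v w =
     op_restrict (op_adjoint (op_sum A1 A2))
       {d + l | d l. d \<in> Domain (coupling_symm_op A1 A2 v) \<and> l \<in> complex_vector.span {w}}"

text \<open>The coupling of \<open>\<Theta>\<^sub>1\<close> and \<open>\<Theta>\<^sub>2\<close> is unique up to a unimodular factor in its channel
  operator, so it is a relation. That \<open>K c = c \<chi>\<close> with \<open>Im \<bbbA> = (\<cdot>, \<chi>) \<chi>\<close>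
  is contained in \<^const>\<open>L_system\<close>, with \<open>\<chi> = K 1\<close>.\<close>

definition is_coupling ::
    "'a::complex_hilbert lsystem \<Rightarrow> 'a \<Rightarrow> 'a \<Rightarrow> real \<Rightarrow>
     'b::complex_hilbert lsystem \<Rightarrow> 'b \<Rightarrow> 'b \<Rightarrow> real \<Rightarrow> ('a \<times> 'b) lsystem \<Rightarrow> bool" where
  "is_coupling \<Theta>1 gp1 gm1 \<kappa>1 \<Theta>2 gp2 gm2 \<kappa>2 \<Theta> \<longleftrightarrow>
     (\<exists>\<alpha> \<beta>. coupling_angles \<kappa>1 \<kappa>2 \<alpha> \<beta> \<and>
        (let v = coupling_vector gp1 gm1 \<kappa>1 gp2 gm2 \<kappa>2 \<alpha>;
             Gp = coupling_deficiency \<alpha> gp1 gp2;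
             Gm = coupling_deficiency \<beta> gm1 gm2
         in symm_op \<Theta> = coupling_symm_op (symm_op \<Theta>1) (symm_op \<Theta>2) v \<and>
            main_op \<Theta> = coupling_main_op (symm_op \<Theta>1) (symm_op \<Theta>2) v
                          (Gp - complex_of_real (\<kappa>1 * \<kappa>2) *\<^sub>C Gm) \<and>
            L_system \<Theta> \<and>
            Gp - Gm \<in> Domain (real_quasi_kernel \<Theta>)))"

end

theory Submission
  imports Defs
begin

text \<open>Let \<open>[f, g] = (A\<^sup>* f, g) - (f, A\<^sup>* g)\<close> be the boundary form, \<open>\<tau> = g\<^sub>+ - \<kappa> g\<^sub>-\<close> and
  \<open>\<tau>\<^sub>* = \<kappa> g\<^sub>+ - g\<^sub>-\<close>. The state space operator acts as \<open>f \<mapsto> A\<^sup>* f - ([f, \<tau>\<^sub>*] / \<chi>(\<tau>)) \<chi>\<close>, so solving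
  \<open>(\<bbbA> - z) x = \<chi>\<close> gives \<open>W(z) = [x, \<tau>] / [x, \<tau>\<^sub>*]\<close> for every \<open>x \<noteq> 0\<close> in \<open>ker (A\<^sup>* - z)\<close>.
  The coupling satisfies Hypothesis I with \<open>G\<^sub>\<plusminus>\<close> and \<open>\<kappa>\<^sub>1 \<kappa>\<^sub>2\<close>, and \<open>\<L>\<^sub>0\<close> is spanned by
  \<open>sin \<alpha> \<tau>\<^sub>1 \<oplus> cos \<beta> \<tau>\<^sub>2\<^sub>*\<close>. Hence for \<open>u\<^sub>k\<close> in \<open>ker (A\<^sub>k\<^sup>* - z)\<close> the vector
  \<open>cos \<beta> [u\<^sub>2, \<tau>\<^sub>2\<^sub>*] u\<^sub>1 \<oplus> - sin \<alpha> [u\<^sub>1, \<tau>\<^sub>1] u\<^sub>2\<close> is a deficiency vector of the coupling, and the two forms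
  in the quotient for it are the products of those for \<open>u\<^sub>1\<close> and \<open>u\<^sub>2\<close>.\<close>

section \<open>Complex Hilbert spaces\<close>

lemma cinner_add_right: "cinner x (y + w) = cinner x y + cinner (x::'a::complex_hilbert) w"
  by (metis cinner_add_left cinner_commute complex_cnj_add)

lemma cinner_scaleC_right: "cinner x (c *\<^sub>C y) = cnj c * cinner (x::'a::complex_hilbert) y"
  by (metis cinner_commute cinner_scaleC_left complex_cnj_mult)

lemma scaleC_minus_one: "(- 1) *\<^sub>C x = - (x::'a::complex_hilbert)"
  using complex_vector.scale_minus_left[of 1 x] complex_vector.scale_one[of x] by simp

lemma cinner_minus_left: "cinner (- x) y = - cinner (x::'a::complex_hilbert) y"
  using cinner_scaleC_left[of "- 1" x y] by (simp add: scaleC_minus_one)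

lemma cinner_minus_right: "cinner x (- y) = - cinner (x::'a::complex_hilbert) y"
  using cinner_scaleC_right[of x "- 1" y] by (simp add: scaleC_minus_one)

lemma cinner_diff_left: "cinner (x - y) w = cinner x w - cinner (y::'a::complex_hilbert) w"
  using cinner_add_left[of x "- y" w] by (simp add: cinner_minus_left)

lemma cinner_diff_right: "cinner x (y - w) = cinner x y - cinner (x::'a::complex_hilbert) w"
  using cinner_add_right[of x y "- w"] by (simp add: cinner_minus_right)

lemma cinner_zero [simp]: "cinner 0 x = 0" "cinner (x::'a::complex_hilbert) 0 = 0"
  using cinner_diff_left[of x x x] cinner_diff_right[of x x x] by simp_all

lemmas cinner_simps = cinner_add_left cinner_add_right cinner_diff_left cinner_diff_right
  cinner_minus_left cinner_minus_right cinner_scaleC_left cinner_scaleC_right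

lemma norm_add_cinner:
  "(norm (x + y))\<^sup>2 = (norm (x::'a::complex_hilbert))\<^sup>2 + 2 * Re (cinner x y) + (norm y)\<^sup>2"
proof -
  have "cinner (x + y) (x + y) = cinner x x + cinner y y + (cinner x y + cinner y x)"
    by (simp add: cinner_simps)
  then have "complex_of_real ((norm (x + y))\<^sup>2) =
      complex_of_real ((norm x)\<^sup>2 + (norm y)\<^sup>2) + (cinner x y + cnj (cinner x y))"
    unfolding cinner_self of_real_add using cinner_commute[of y x] by simp
  then show ?thesis by (simp add: complex_add_cnj complex_eq_iff)
qed

lemma norm_diff_cinner:
  "(norm (x - y))\<^sup>2 = (norm (x::'a::complex_hilbert))\<^sup>2 - 2 * Re (cinner x y) + (norm y)\<^sup>2"
  using norm_add_cinner[of x "- y"] by (simp add: cinner_minus_right)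

lemma Re_cinner_le: "Re (cinner x y) \<le> norm x * norm (y::'a::complex_hilbert)"
proof -
  have "(norm (x + y))\<^sup>2 \<le> (norm x + norm y)\<^sup>2"
    by (simp add: norm_triangle_ineq power_mono)
  then show ?thesis by (simp add: norm_add_cinner power2_sum)
qed

lemma norm_scaleC: "norm (c *\<^sub>C x) = cmod c * norm (x::'a::complex_hilbert)"
proof -
  have "complex_of_real ((norm (c *\<^sub>C x))\<^sup>2) = complex_of_real ((cmod c)\<^sup>2 * (norm x)\<^sup>2)"
    unfolding cinner_self[symmetric] of_real_mult complex_norm_square
    by (simp add: cinner_simps)
  then have "(norm (c *\<^sub>C x))\<^sup>2 = (cmod c * norm x)\<^sup>2"
    unfolding power_mult_distrib of_real_eq_iff .
  then show ?thesis
    by simp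
qed

text \<open>A point \<open>f\<close> of \<open>D\<close> nearer to \<open>h\<close> than
  \<open>norm h\<close> would give \<open>(norm h)\<^sup>2 = Re (cinner (h - f) h)\<close>, which
  Cauchy-Schwarz bounds strictly below \<open>(norm h)\<^sup>2\<close>.\<close>

lemma cinner_dense_eq_0:
  fixes h :: "'a::complex_hilbert"
  assumes D: "closure D = UNIV" and orth: "\<And>f. f \<in> D \<Longrightarrow> cinner f h = 0"
  shows "h = 0"
proof (rule ccontr)
  assume "h \<noteq> 0"
  then have "0 < norm h" by simp
  moreover have "h \<in> closure D" using D by simp
  ultimately obtain f where f: "f \<in> D" "dist f h < norm h"
    by (metis closure_approachable)
  have "Re (cinner (h - f) h) = (norm h)\<^sup>2"
    using orth[OF f(1)] by (simp add: cinner_diff_left cinner_self)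
  then have "(norm h)\<^sup>2 \<le> norm (h - f) * norm h"
    using Re_cinner_le[of "h - f" h] by simp
  then show False
    using f(2) \<open>0 < norm h\<close> by (simp add: power2_eq_square dist_norm norm_minus_commute)
qed

section \<open>Orthogonal projection onto a closed subspace\<close>

lemma parallelogram:
  "(norm (x + y))\<^sup>2 + (norm (x - y))\<^sup>2 = 2 * (norm (x::'a::complex_hilbert))\<^sup>2 + 2 * (norm y)\<^sup>2"
  by (simp add: norm_add_cinner norm_diff_cinner)

text \<open>A sequence in \<open>M\<close> minimising the distance to \<open>x\<close> is Cauchy by
  the parallelogram law; completeness gives a nearest point, and first-order variation at it gives
  orthogonality.\<close>

lemma projection_exists:
  fixes M :: "'a::complex_hilbert set"
  assumes sub: "complex_vector.subspace M" and cl: "closed M"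
  shows "\<exists>m\<in>M. \<forall>y\<in>M. cinner (x - m) y = 0"
proof -
  define d where "d = (INF y\<in>M. (norm (x - y))\<^sup>2)"
  have bdd: "bdd_below ((\<lambda>y. (norm (x - y))\<^sup>2) ` M)"
    by (rule bdd_belowI2[of _ 0]) simp
  have M0: "0 \<in> M" using sub by (rule complex_vector.subspace_0)
  have dle: "d \<le> (norm (x - y))\<^sup>2" if "y \<in> M" for y
    unfolding d_def by (rule cINF_lower[OF bdd that])
  have "\<exists>y\<in>M. (norm (x - y))\<^sup>2 < d + 1 / real (Suc n)" for n
    using cINF_less_iff[of M "\<lambda>y. (norm (x - y))\<^sup>2" "d + 1 / real (Suc n)"] bdd M0
    by (force simp: d_def)
  then obtain Y where Y: "\<And>n. Y n \<in> M" "\<And>n. (norm (x - Y n))\<^sup>2 < d + 1 / real (Suc n)"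
    by metis
  have est: "(norm (Y n - Y m))\<^sup>2 \<le> 2 / real (Suc n) + 2 / real (Suc m)" for n m
  proof -
    \<comment> \<open>The midpoint stays in \<open>M\<close>, so its squared distance to
      \<open>x\<close> is at least \<open>d\<close>; this is what forces \<open>Y n\<close> and
      \<open>Y m\<close> together.\<close>
    have "(1/2) *\<^sub>C (Y n + Y m) \<in> M"
      using Y(1) sub by (simp add: complex_vector.subspace_add complex_vector.subspace_scale)
    then have 1: "d \<le> (norm (x - (1/2) *\<^sub>C (Y n + Y m)))\<^sup>2"
      by (rule dle)
    have "(x - Y n) + (x - Y m) = 2 *\<^sub>C (x - (1/2) *\<^sub>C (Y n + Y m))"
      using scaleC_add_left[of 1 1 x]
      by (simp add: complex_vector.scale_right_diff_distrib algebra_simps)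
    then have "(norm ((x - Y n) + (x - Y m)))\<^sup>2 = 4 * (norm (x - (1/2) *\<^sub>C (Y n + Y m)))\<^sup>2"
      by (simp add: norm_scaleC power_mult_distrib)
    moreover have "norm ((x - Y n) - (x - Y m)) = norm (Y n - Y m)"
      by (simp add: norm_minus_commute)
    ultimately show ?thesis
      using parallelogram[of "x - Y n" "x - Y m"] Y(2)[of n] Y(2)[of m] 1 by simp
  qed
  have "Cauchy Y"
  proof (rule metric_CauchyI)
    fix e :: real assume "0 < e"
    obtain N where N: "4 / e\<^sup>2 < real N"
      using reals_Archimedean2 by blast
    have *: "2 / real (Suc n) < e\<^sup>2 / 2" if "n \<ge> N" for n
    proof -
      have "4 / e\<^sup>2 < real (Suc n)" using N that by linarith
      then show ?thesis using \<open>0 < e\<close> by (simp add: field_simps)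
    qed
    show "\<exists>N. \<forall>m\<ge>N. \<forall>n\<ge>N. dist (Y m) (Y n) < e"
    proof (intro exI allI impI)
      fix m n assume "N \<le> m" "N \<le> n"
      then have "(norm (Y m - Y n))\<^sup>2 < e\<^sup>2"
        using est[of m n] *[of m] *[of n] by linarith
      then show "dist (Y m) (Y n) < e"
        using \<open>0 < e\<close> by (simp add: dist_norm power2_less_imp_less)
    qed
  qed
  then obtain m where lim: "Y \<longlonglongrightarrow> m"
    using Cauchy_convergent convergent_def by blast
  have m: "m \<in> M"
    using cl Y(1) lim closed_sequentially by blast
  have "(\<lambda>n. (norm (x - Y n))\<^sup>2) \<longlonglongrightarrow> (norm (x - m))\<^sup>2"
    by (intro tendsto_intros lim)
  moreover have "(\<lambda>n. d + 1 / real (Suc n)) \<longlonglongrightarrow> d + 0"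
    by (intro tendsto_add tendsto_const LIMSEQ_Suc[OF lim_1_over_n])
  ultimately have "(norm (x - m))\<^sup>2 \<le> d + 0"
    by (rule LIMSEQ_le) (use Y(2) less_imp_le in blast)
  then have md: "(norm (x - m))\<^sup>2 \<le> d" by simp
  show ?thesis
  proof (intro bexI[OF _ m] ballI)
    fix y assume y: "y \<in> M"
    define p where "p = cinner (x - m) y"
    \<comment> \<open>Moving \<open>m\<close> by \<open>t * p\<close> times \<open>y\<close> changes
      the squared distance by \<open>t * (cmod p)\<^sup>2 * (t * (norm y)\<^sup>2 - 2)\<close>. The
      added 1 keeps \<open>t\<close> defined for \<open>y = 0\<close> and makes the last factor
      negative.\<close>
    define t where "t = 1 / ((norm y)\<^sup>2 + 1)"
    have "0 < (norm y)\<^sup>2 + 1"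
      by (simp add: add_nonneg_pos)
    then have t: "0 < t" "t * (norm y)\<^sup>2 < 1"
      unfolding t_def by (simp_all add: divide_less_eq)
    have "m + (of_real t * p) *\<^sub>C y \<in> M"
      using m y sub by (simp add: complex_vector.subspace_add complex_vector.subspace_scale)
    then have "d \<le> (norm (x - (m + (of_real t * p) *\<^sub>C y)))\<^sup>2"
      by (rule dle)
    then have "(norm (x - m))\<^sup>2 \<le> (norm ((x - m) - (of_real t * p) *\<^sub>C y))\<^sup>2"
      using md unfolding diff_diff_eq by (rule order_trans[rotated])
    also have "\<dots> = (norm (x - m))\<^sup>2 - 2 * (t * (cmod p)\<^sup>2) + t\<^sup>2 * (cmod p)\<^sup>2 * (norm y)\<^sup>2"
    proof -
      have "cinner (x - m) ((of_real t * p) *\<^sub>C y) = of_real (t * (cmod p)\<^sup>2)"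
        unfolding cinner_scaleC_right p_def[symmetric] of_real_mult complex_norm_square
        by simp
      then show ?thesis
        unfolding norm_diff_cinner[of "x - m"]
        by (simp add: norm_scaleC norm_mult power_mult_distrib)
    qed
    finally have "0 \<le> (t * (cmod p)\<^sup>2) * (t * (norm y)\<^sup>2 - 2)"
      by (simp add: power2_eq_square algebra_simps)
    then have "t * (cmod p)\<^sup>2 \<le> 0"
      using t(2) by (simp add: zero_le_mult_iff)
    then have "(cmod p)\<^sup>2 \<le> 0"
      using t(1) by (simp add: mult_le_0_iff)
    then show "cinner (x - m) y = 0"
      by (simp add: p_def)
  qed
qed

section \<open>The adjoint of a symmetric operator\<close>

lemma op_adjoint_iff: "(g, h) \<in> op_adjoint T \<longleftrightarrow> (\<forall>f w. (f, w) \<in> T \<longrightarrow> cinner w g = cinner f h)"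
  unfolding op_adjoint_def by auto

lemma op_adjoint_antimono: "S \<subseteq> T \<Longrightarrow> op_adjoint T \<subseteq> op_adjoint S"
  unfolding op_adjoint_def by auto

lemma subspace_op_adjoint: "complex_vector.subspace (op_adjoint T)"
  by (rule complex_vector.subspaceI)
    (auto simp: op_adjoint_iff zero_prod_def scaleC_prod_def cinner_simps)

lemma op_adjoint_add:
  "(f, h) \<in> op_adjoint T \<Longrightarrow> (f', h') \<in> op_adjoint T \<Longrightarrow> (f + f', h + h') \<in> op_adjoint T"
  by (auto simp: op_adjoint_iff cinner_simps)

lemma op_adjoint_scale: "(f, h) \<in> op_adjoint T \<Longrightarrow> (c *\<^sub>C f, c *\<^sub>C h) \<in> op_adjoint T"
  by (auto simp: op_adjoint_iff cinner_simps)

lemma single_valued_op_adjoint: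
  assumes "densely_defined T" shows "single_valued (op_adjoint T)"
proof (rule single_valuedI)
  fix g h h' assume "(g, h) \<in> op_adjoint T" "(g, h') \<in> op_adjoint T"
  then have "cinner f (h - h') = 0" if "f \<in> Domain T" for f
    using that unfolding op_adjoint_iff by (metis Domain.cases cinner_diff_right right_minus_eq)
  then show "h = h'"
    using assms cinner_dense_eq_0[of "Domain T" "h - h'"] by (simp add: densely_defined_def)
qed

text \<open>The orthogonal complement of the graph of \<open>A\<close> in the graph of \<open>A\<^sup>*\<close> consists of the
  pairs \<open>(n, A\<^sup>* n)\<close> with \<open>A\<^sup>* A\<^sup>* n = - n\<close>.\<close>

lemma von_Neumann_decomposition:
  assumes lin: "linear_operator A" and cl: "closed A" and sym: "A \<subseteq> op_adjoint A"
    and f: "f \<in> Hplus A"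
  shows "\<exists>d n1 n2. d \<in> Domain A \<and> n1 \<in> op_ker (op_adjoint A) \<i> \<and>
    n2 \<in> op_ker (op_adjoint A) (- \<i>) \<and> f = d + n1 + n2"
proof -
  obtain h where fh: "(f, h) \<in> op_adjoint A"
    using f by (auto simp: Hplus_def)
  \<comment> \<open>The pair \<open>(d, a)\<close> is the projection of \<open>(f, h)\<close> onto
    the graph of \<open>A\<close>, a closed subspace of the product space.\<close>
  obtain d a where da: "(d, a) \<in> A"
    and orth: "\<And>g w. (g, w) \<in> A \<Longrightarrow> cinner (f - d) g + cinner (h - a) w = 0"
  proof -
    obtain m where "m \<in> A" "\<And>y. y \<in> A \<Longrightarrow> cinner ((f, h) - m) y = 0"
      using projection_exists[of A "(f, h)"] lin cl unfolding linear_operator_def by metis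
    then show ?thesis
      using that[of "fst m" "snd m"] by (force simp: cinner_prod_def)
  qed
  define n k where "n = f - d" and "k = h - a"
  have nk: "(n, k) \<in> op_adjoint A"
    using fh da sym by (auto simp: n_def k_def op_adjoint_iff cinner_simps)
  \<comment> \<open>Orthogonality of \<open>(n, k)\<close> to the graph of \<open>A\<close>, read as
    a statement about the adjoint relation.\<close>
  have "(k, - n) \<in> op_adjoint A"
    unfolding op_adjoint_iff
  proof (intro allI impI)
    fix g w assume "(g, w) \<in> A"
    then have "cinner n g + cinner k w = 0" using orth by (simp add: n_def k_def)
    then show "cinner w k = cinner g (- n)"
      using cinner_commute[of w k] cinner_commute[of g n]
      by (metis cinner_minus_right complex_cnj_minus eq_neg_iff_add_eq_0 add.commute)
  qed
  then have kn: "(c *\<^sub>C k, - (c *\<^sub>C n)) \<in> op_adjoint A" for c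
    using op_adjoint_scale[of k "- n" A c] by (simp add: complex_vector.scale_minus_right)
  \<comment> \<open>For \<open>e = - \<i>\<close> the second entry is \<open>\<i>\<close> times the
    first, for \<open>e = \<i>\<close> it is \<open>- \<i>\<close> times the first; with
    \<open>c = 1/2\<close> the two first entries add up to \<open>n\<close>.\<close>
  have split: "(c *\<^sub>C (n + e *\<^sub>C k), c *\<^sub>C (k - e *\<^sub>C n)) \<in> op_adjoint A" for c e
    using op_adjoint_scale[OF op_adjoint_add[OF nk kn[of e]], of c] by simp
  have n1: "(1/2) *\<^sub>C (n + (- \<i>) *\<^sub>C k) \<in> op_ker (op_adjoint A) \<i>"
    using split[of "1/2" "- \<i>"]
    by (simp add: op_ker_def complex_vector.scale_right_diff_distrib scaleC_add_right algebra_simps)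
  have n2: "(1/2) *\<^sub>C (n + \<i> *\<^sub>C k) \<in> op_ker (op_adjoint A) (- \<i>)"
    using split[of "1/2" "\<i>"]
    by (simp add: op_ker_def complex_vector.scale_right_diff_distrib scaleC_add_right algebra_simps)
  have "(1/2) *\<^sub>C n + (1/2) *\<^sub>C n = n"
    using scaleC_add_left[of "1/2" "1/2" n] by simp
  then have "f = d + (1/2) *\<^sub>C (n + (- \<i>) *\<^sub>C k) + (1/2) *\<^sub>C (n + \<i> *\<^sub>C k)"
    by (simp add: n_def scaleC_add_right algebra_simps)
  then show ?thesis
    using da n1 n2 by blast
qed

lemma dim_1_scale:
  assumes "complex_vector.dim V = 1" "g \<in> V" "g \<noteq> 0" "x \<in> V"
  shows "\<exists>c. x = c *\<^sub>C g"
proof -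
  obtain b where b: "b \<subseteq> V" "complex_vector.independent b" "V \<subseteq> complex_vector.span b" "card b = 1"
    using complex_vector.basis_exists assms(1) by metis
  then obtain e where "b = {e}"
    using card_1_singletonE by metis
  then have e: "y \<in> V \<Longrightarrow> \<exists>k. y = k *\<^sub>C e" for y
    using b(3) by (force simp: complex_vector.span_singleton)
  obtain k l where "g = k *\<^sub>C e" "x = l *\<^sub>C e"
    using e assms by metis
  moreover have "k \<noteq> 0" using assms(3) \<open>g = k *\<^sub>C e\<close> by auto
  ultimately have "x = (l / k) *\<^sub>C g" by simp
  then show ?thesis ..
qed

section \<open>The boundary form\<close>

text \<open>The Green form. For densely defined symmetric \<open>A\<close> it vanishes as soon as
  one argument from \<open>Hplus A\<close> lies in \<open>Domain A\<close>, so it sees only boundary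
  values.\<close>

definition bform :: "'a::complex_hilbert operator \<Rightarrow> 'a \<Rightarrow> 'a \<Rightarrow> complex" where
  "bform A f g =
     cinner (op_app (op_adjoint A) f) g - cinner f (op_app (op_adjoint A) g)"

lemma op_app_eq: "single_valued T \<Longrightarrow> (f, h) \<in> T \<Longrightarrow> op_app T f = h"
  unfolding op_app_def by (blast dest: single_valuedD)

lemmas op_app_adjoint = op_app_eq[OF single_valued_op_adjoint]

lemma HplusI: "(f, h) \<in> op_adjoint A \<Longrightarrow> f \<in> Hplus A"
  by (auto simp: Hplus_def)

lemma op_app_adjoint_mem:
  assumes "densely_defined A" "f \<in> Hplus A"
  shows "(f, op_app (op_adjoint A) f) \<in> op_adjoint A"
  using assms op_app_adjoint by (force simp: Hplus_def)

lemma subspace_Hplus: "complex_vector.subspace (Hplus A)"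
proof (rule complex_vector.subspaceI)
  show "0 \<in> Hplus A"
    using HplusI[of 0 0] by (simp add: op_adjoint_iff)
qed (auto simp: Hplus_def dest: op_adjoint_add op_adjoint_scale)

lemmas Hplus_add = complex_vector.subspace_add[OF subspace_Hplus]
  and Hplus_diff = complex_vector.subspace_diff[OF subspace_Hplus]
  and Hplus_scale = complex_vector.subspace_scale[OF subspace_Hplus]

lemma bform_adjoint:
  assumes "densely_defined A" "(f, f') \<in> op_adjoint A" "(g, g') \<in> op_adjoint A"
  shows "bform A f g = cinner f' g - cinner f g'"
  using assms by (simp add: bform_def op_app_adjoint)

lemma bform_commute: "bform A g f = - cnj (bform A f g)"
  using cinner_commute[of "op_app (op_adjoint A) f" g] cinner_commute[of f "op_app (op_adjoint A) g"]
  by (simp add: bform_def)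

lemma op_app_adjoint_add:
  assumes "densely_defined A" "f \<in> Hplus A" "g \<in> Hplus A"
  shows "op_app (op_adjoint A) (f + g) = op_app (op_adjoint A) f + op_app (op_adjoint A) g"
  using assms by (intro op_app_adjoint op_adjoint_add op_app_adjoint_mem)

lemma op_app_adjoint_scale:
  assumes "densely_defined A" "f \<in> Hplus A"
  shows "op_app (op_adjoint A) (c *\<^sub>C f) = c *\<^sub>C op_app (op_adjoint A) f"
  using assms by (intro op_app_adjoint op_adjoint_scale op_app_adjoint_mem)

lemma bform_add_left:
  assumes "densely_defined A" "f \<in> Hplus A" "g \<in> Hplus A"
  shows "bform A (f + g) h = bform A f h + bform A g h"
  using assms by (simp add: bform_def op_app_adjoint_add cinner_simps)

lemma bform_scale_left:
  assumes "densely_defined A" "f \<in> Hplus A"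
  shows "bform A (c *\<^sub>C f) h = c * bform A f h"
  using assms by (simp add: bform_def op_app_adjoint_scale cinner_simps algebra_simps)

lemma bform_diff_left:
  assumes "densely_defined A" "f \<in> Hplus A" "g \<in> Hplus A"
  shows "bform A (f - g) h = bform A f h - bform A g h"
  using bform_add_left[OF assms(1,2) Hplus_scale[OF assms(3)], of "- 1" h]
    bform_scale_left[OF assms(1,3), of "- 1" h]
  by (simp add: scaleC_minus_one)

lemma bform_add_right:
  assumes "densely_defined A" "f \<in> Hplus A" "g \<in> Hplus A"
  shows "bform A h (f + g) = bform A h f + bform A h g"
  unfolding bform_commute[of A h "f + g"] bform_commute[of A h f] bform_commute[of A h g]
    bform_add_left[OF assms, of h] by simp

lemma bform_diff_right:
  assumes "densely_defined A" "f \<in> Hplus A" "g \<in> Hplus A"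
  shows "bform A h (f - g) = bform A h f - bform A h g"
  unfolding bform_commute[of A h "f - g"] bform_commute[of A h f] bform_commute[of A h g]
    bform_diff_left[OF assms, of h] by simp

lemma bform_scale_right:
  assumes "densely_defined A" "f \<in> Hplus A"
  shows "bform A h (c *\<^sub>C f) = cnj c * bform A h f"
  unfolding bform_commute[of A h "c *\<^sub>C f"] bform_commute[of A h f]
    bform_scale_left[OF assms, of c h] by simp

lemma bform_symmetric_right:
  assumes "densely_defined A" "A \<subseteq> op_adjoint A" "f \<in> Hplus A" "d \<in> Domain A"
  shows "bform A f d = 0"
proof -
  obtain a where a: "(d, a) \<in> A" using assms(4) by blast
  have "cinner a f = cinner d (op_app (op_adjoint A) f)"
    using op_app_adjoint_mem[OF assms(1,3)] a by (simp add: op_adjoint_iff)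
  then have "bform A d f = 0"
    using a assms(1,2) op_app_adjoint[of A d a] by (auto simp: bform_def)
  then show ?thesis
    using bform_commute[of A f d] by simp
qed

lemma bform_symmetric_left:
  assumes "densely_defined A" "A \<subseteq> op_adjoint A" "f \<in> Hplus A" "d \<in> Domain A"
  shows "bform A d f = 0"
  using bform_symmetric_right[OF assms] bform_commute[of A d f] by simp

lemma bform_op_ker:
  assumes "densely_defined A" "f \<in> op_ker (op_adjoint A) z" "g \<in> op_ker (op_adjoint A) w"
  shows "bform A f g = (z - cnj w) * cinner f g"
  using assms bform_adjoint[OF assms(1), of f "z *\<^sub>C f" g "w *\<^sub>C g"]
  by (simp add: op_ker_def cinner_simps algebra_simps)

lemma op_ker_Hplus: "f \<in> op_ker (op_adjoint A) z \<Longrightarrow> f \<in> Hplus A"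
  by (auto simp: op_ker_def intro: HplusI)

lemma subspace_op_ker_adjoint: "complex_vector.subspace (op_ker (op_adjoint A) z)"
proof (rule complex_vector.subspaceI)
  show "0 \<in> op_ker (op_adjoint A) z"
    by (simp add: op_ker_def op_adjoint_iff)
next
  fix x y assume "x \<in> op_ker (op_adjoint A) z" "y \<in> op_ker (op_adjoint A) z"
  then show "x + y \<in> op_ker (op_adjoint A) z"
    using op_adjoint_add[of x "z *\<^sub>C x" A y "z *\<^sub>C y"] by (simp add: op_ker_def scaleC_add_right)
next
  fix c x assume "x \<in> op_ker (op_adjoint A) z"
  then show "c *\<^sub>C x \<in> op_ker (op_adjoint A) z"
    using op_adjoint_scale[of x "z *\<^sub>C x" A c] by (simp add: op_ker_def mult.commute)
qed

section \<open>Injectivity and surjectivity of \<open>T - z\<close> on the resolvent set\<close>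

lemma resolvent_set_op_ker:
  assumes z: "z \<in> resolvent_set T" and T: "complex_vector.subspace T" and x: "(x, z *\<^sub>C x) \<in> T"
  shows "x = 0"
proof -
  obtain R where R: "{(g - z *\<^sub>C f, f) | f g. (f, g) \<in> T} = {(h, R h) | h. True}"
    using z unfolding resolvent_set_def by blast
  have "(0, 0) \<in> T"
    using complex_vector.subspace_0[OF T] by (simp add: zero_prod_def)
  then have "(0, 0) \<in> {(g - z *\<^sub>C f, f) | f g. (f, g) \<in> T}"
    by force
  moreover have "(0, x) \<in> {(g - z *\<^sub>C f, f) | f g. (f, g) \<in> T}"
    using x by force
  ultimately show ?thesis unfolding R by simp
qed

lemma resolvent_set_surj:
  assumes "z \<in> resolvent_set T"
  shows "\<exists>f. (f, h + z *\<^sub>C f) \<in> T"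
proof -
  obtain R where R: "{(g - z *\<^sub>C f, f) | f g. (f, g) \<in> T} = {(h, R h) | h. True}"
    using assms unfolding resolvent_set_def by blast
  have "(h, R h) \<in> {(g - z *\<^sub>C f, f) | f g. (f, g) \<in> T}"
    unfolding R by blast
  then show ?thesis
    by (force simp: algebra_simps)
qed

section \<open>A single system\<close>

text \<open>Recovers \<open>B f g\<close> and \<open>cnj (B g f)\<close> once the real part of the
  operator gives their sum and the imaginary part their difference.\<close>

lemma half_sum_diff:
  fixes u v w c :: complex
  assumes "u + v = 2 * w" "u - v = 2 * c"
  shows "u = w + c" "v = w - c"
  using assms by (auto simp: complex_eq_iff)

locale hypothesis_I_system =
  fixes \<Theta> :: "'a::complex_hilbert lsystem" and gp gm :: 'a and \<kappa> :: real
  assumes L: "L_system \<Theta>" and hyp: "hypothesis_I \<Theta> gp gm \<kappa>"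
begin

abbreviation "A \<equiv> symm_op \<Theta>"
abbreviation "T \<equiv> main_op \<Theta>"
abbreviation "B \<equiv> state_op \<Theta>"
abbreviation "H \<equiv> Hplus (symm_op \<Theta>)"
abbreviation "S \<equiv> op_app (op_adjoint (symm_op \<Theta>))"
abbreviation "form \<equiv> bform (symm_op \<Theta>)"

text \<open>The channel vector as an antilinear functional: \<open>chi g\<close> is the pairing
  (\<chi>, g), hence (f, \<chi>) is \<open>cnj (chi f)\<close>.\<close>

definition chi :: "'a \<Rightarrow> complex" where "chi = chan_op \<Theta> 1"
definition tau :: 'a where "tau = gp - complex_of_real \<kappa> *\<^sub>C gm"
text \<open>The counterpart of \<open>tau\<close> for the adjoint of \<open>T\<close>: the
  coefficients make the boundary form of \<open>tau\<close> and \<open>tau_adj\<close>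
  vanish.\<close>

definition tau_adj :: 'a where "tau_adj = complex_of_real \<kappa> *\<^sub>C gp - gm"

lemma dense: "densely_defined A" and sym: "A \<subseteq> op_adjoint A" and lin: "linear_operator A"
  and cl: "closed A"
  using L by (auto simp: L_system_def symmetric_operator_11_def)

lemma T_facts: "linear_operator T" "A \<subseteq> T" "T \<subseteq> op_adjoint A"
    "Domain A = Domain T \<inter> Domain (op_adjoint T)"
  using L by (auto simp: L_system_def class_Lambda_def)

lemma adj_T_sub: "op_adjoint T \<subseteq> op_adjoint A"
  using T_facts(2) by (rule op_adjoint_antimono)

lemma \<kappa>: "0 \<le> \<kappa>" "\<kappa> < 1" and norm_g [simp]: "norm gp = 1" "norm gm = 1"
  and gp: "gp \<in> op_ker (op_adjoint A) \<i>" and gm: "gm \<in> op_ker (op_adjoint A) (- \<i>)"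
  and tau_T: "tau \<in> Domain T" and phi: "gp - gm \<in> Domain (real_quasi_kernel \<Theta>)"
  using hyp by (auto simp: hypothesis_I_def tau_def)

lemma g_H [simp]: "gp \<in> H" "gm \<in> H"
  using gp gm by (auto intro: op_ker_Hplus)

lemma tau_H [simp]: "tau \<in> H" "tau_adj \<in> H"
  by (simp_all add: tau_def tau_adj_def Hplus_diff Hplus_scale)

lemma Domain_H: "f \<in> Domain T \<Longrightarrow> f \<in> H" "f \<in> Domain (op_adjoint T) \<Longrightarrow> f \<in> H"
    "f \<in> Domain A \<Longrightarrow> f \<in> H"
  using T_facts(3) adj_T_sub sym by (auto simp: Hplus_def)

lemmas form_add_left = bform_add_left[OF dense]
  and form_add_right = bform_add_right[OF dense]
  and form_diff_left = bform_diff_left[OF dense]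
  and form_diff_right = bform_diff_right[OF dense]
  and form_scale_left = bform_scale_left[OF dense]
  and form_scale_right = bform_scale_right[OF dense]
  and form_A_left = bform_symmetric_left[OF dense sym]
  and form_A_right = bform_symmetric_right[OF dense sym]

lemmas form_simps = form_add_left form_add_right form_diff_left form_diff_right
  form_scale_left form_scale_right form_A_left form_A_right

lemma form_g [simp]: "form gp gp = 2 * \<i>" "form gm gm = - 2 * \<i>" "form gp gm = 0" "form gm gp = 0"
  using bform_op_ker[OF dense gp gp] bform_op_ker[OF dense gm gm]
    bform_op_ker[OF dense gp gm] bform_op_ker[OF dense gm gp]
  by (simp_all add: cinner_self)

lemma form_tau: "form f tau = form f gp - \<kappa> * form f gm"
    "form f tau_adj = \<kappa> * form f gp - form f gm"
    "form tau f = form gp f - \<kappa> * form gm f"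
    "form tau_adj f = \<kappa> * form gp f - form gm f"
  by (simp_all add: tau_def tau_adj_def form_simps Hplus_scale)

section \<open>Pairings of the state-space operator with the domains of \<open>T\<close> and its
  adjoint\<close>

lemma T_app: "f \<in> Domain T \<Longrightarrow> (f, S f) \<in> T"
  using T_facts(3) op_app_adjoint[OF dense] by blast

lemma adj_T_app: "f \<in> Domain (op_adjoint T) \<Longrightarrow> (f, S f) \<in> op_adjoint T"
  using adj_T_sub op_app_adjoint[OF dense] by blast

lemma subspace_Domain_T: "complex_vector.subspace (Domain T)"
proof (rule complex_vector.subspaceI)
  have s: "complex_vector.subspace T" using T_facts(1) by (simp add: linear_operator_def)
  show "0 \<in> Domain T"
    using complex_vector.subspace_0[OF s] by (auto simp: zero_prod_def)
  show "x + y \<in> Domain T" if "x \<in> Domain T" "y \<in> Domain T" for x y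
    using that complex_vector.subspace_add[OF s] by (fastforce)
  show "c *\<^sub>C x \<in> Domain T" if "x \<in> Domain T" for c x
    using that complex_vector.subspace_scale[OF s] by (fastforce simp: scaleC_prod_def)
qed

lemma B_T: "f \<in> Domain T \<Longrightarrow> g \<in> H \<Longrightarrow> B f g = cinner (S f) g"
  using L T_app[of f] unfolding L_system_def star_extension_def rig_extends_def
  by (fastforce simp: emb_def)

text \<open>The adjoint of \<open>B\<close> extends that of \<open>T\<close>; conjugating its
  pairing determines \<open>B g\<close> on \<open>Domain (op_adjoint T)\<close> for every
  \<open>g\<close> in \<open>H\<close>.\<close>

lemma B_adj_T:
  assumes "f \<in> Domain (op_adjoint T)" "g \<in> H" shows "B g f = cinner g (S f)"
proof -
  have "rig_adjoint A B f = emb A (S f)"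
    using L adj_T_app[OF assms(1)] unfolding L_system_def star_extension_def rig_extends_def
    by fastforce
  then have "cnj (B g f) = cinner (S f) g"
    using assms(2) by (simp add: rig_adjoint_def emb_def fun_eq_iff split: if_splits)
  then show ?thesis
    using cinner_commute[of g "S f"] by (metis complex_cnj_cnj)
qed

lemma chan_op_eq: "chan_op \<Theta> c = (\<lambda>g. c * chi g)"
proof -
  have "chan_op \<Theta> (c * 1) = (\<lambda>g. c * chan_op \<Theta> 1 g)"
    using L unfolding L_system_def bounded_chan_def by blast
  then show ?thesis by (simp add: chi_def)
qed

lemma B_Im:
  assumes "f \<in> H" "g \<in> H"
  shows "B f g - cnj (B g f) = 2 * \<i> * cnj (chi f) * chi g"
proof -
  have "rig_Im A B f g = cnj (chi f) * chi g"
    using L assms(1) by (simp add: L_system_def chan_op_eq chan_adjoint_def)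
  then show ?thesis
    using assms(2) by (simp add: rig_Im_def rig_adjoint_def field_simps)
qed

section \<open>The channel functional on the domain of \<open>T\<close>\<close>

lemma chi_Hminus: "chi \<in> Hminus A"
  using L by (auto simp: L_system_def bounded_chan_def chi_def)

lemma chi_add: "f \<in> H \<Longrightarrow> g \<in> H \<Longrightarrow> chi (f + g) = chi f + chi g"
  and chi_scale: "f \<in> H \<Longrightarrow> chi (c *\<^sub>C f) = cnj c * chi f"
  and chi_off: "f \<notin> H \<Longrightarrow> chi f = 0"
  using chi_Hminus by (auto simp: Hminus_def)

lemma chi_diff: "f \<in> H \<Longrightarrow> g \<in> H \<Longrightarrow> chi (f - g) = chi f - chi g"
  using chi_add[of f "(- 1) *\<^sub>C g"] chi_scale[of g "- 1"] Hplus_scale[of g A "- 1"]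
  by (simp add: scaleC_minus_one)

lemma B_Hminus: "f \<in> H \<Longrightarrow> B f \<in> Hminus A"
  using L by (auto simp: L_system_def star_extension_def bounded_rig_def)

lemma B_add_right: "f \<in> H \<Longrightarrow> g \<in> H \<Longrightarrow> h \<in> H \<Longrightarrow> B f (g + h) = B f g + B f h"
  and B_scale_right: "f \<in> H \<Longrightarrow> g \<in> H \<Longrightarrow> B f (c *\<^sub>C g) = cnj c * B f g"
  and B_off: "f \<in> H \<Longrightarrow> g \<notin> H \<Longrightarrow> B f g = 0"
  using B_Hminus[of f] by (auto simp: Hminus_def)

text \<open>On \<open>Domain A\<close> the number \<open>B f f\<close> is
  \<open>cinner (S f) f\<close>, real by symmetry, so the imaginary part
  \<open>cnj (chi f) * chi f\<close> is zero.\<close>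

lemma chi_A: "f \<in> Domain A \<Longrightarrow> chi f = 0"
proof -
  assume f: "f \<in> Domain A"
  then have fH: "f \<in> H" by (rule Domain_H)
  have "f \<in> Domain T" using f T_facts(4) by blast
  then have 1: "B f f = cinner (S f) f" using fH by (rule B_T)
  have "form f f = 0" using form_A_left[OF fH f] .
  then have "cinner (S f) f = cnj (cinner (S f) f)"
    using cinner_commute[of f "S f"] by (simp add: bform_def)
  then have "cnj (chi f) * chi f = 0"
    using B_Im[OF fH fH] 1 by simp
  then show ?thesis by simp
qed

text \<open>Both \<open>B f h\<close> and \<open>B h f\<close> are computed by \<open>T\<close>
  here, so the boundary form is the imaginary part of \<open>B\<close> up to the factor
  \<open>2 * \<i>\<close>.\<close>

lemma form_T:
  assumes "f \<in> Domain T" "h \<in> Domain T"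
  shows "form f h = 2 * \<i> * cnj (chi f) * chi h"
  using B_T[OF assms(1) Domain_H(1)[OF assms(2)]] B_T[OF assms(2) Domain_H(1)[OF assms(1)]]
    B_Im[OF Domain_H(1)[OF assms(1)] Domain_H(1)[OF assms(2)]] cinner_commute[of f "S h"]
  by (simp add: bform_def)

text \<open>By \<open>form_T\<close> such an \<open>f\<close> annihilates \<open>Domain T\<close> in
  the boundary form, hence lies in the domain of the adjoint as well, and the two domains meet in
  \<open>Domain A\<close>.\<close>

lemma T_chi_0:
  assumes f: "f \<in> Domain T" and 0: "chi f = 0"
  shows "f \<in> Domain A"
proof -
  have "(f, S f) \<in> op_adjoint T"
    unfolding op_adjoint_iff
  proof (intro allI impI)
    fix h w assume hw: "(h, w) \<in> T"
    then have "w = S h"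
      using T_facts(3) op_app_adjoint[OF dense] by blast
    moreover have "form h f = 0"
      using form_T[of h f] hw f 0 by auto
    ultimately show "cinner w f = cinner h (S f)"
      by (simp add: bform_def)
  qed
  then show ?thesis using f T_facts(4) by blast
qed

lemma \<kappa>_sq: "complex_of_real \<kappa> * complex_of_real \<kappa> \<noteq> 1"
proof -
  have "\<kappa> * \<kappa> < 1" using \<kappa> by (simp add: mult_le_one mult_less_cancel_right2 order_le_less_trans[OF mult_left_le])
  then show ?thesis by (metis less_irrefl of_real_eq_1_iff of_real_mult)
qed

text \<open>Evaluate the form of \<open>tau\<close> with itself twice: by \<open>form_T\<close>, and
  from the deficiency vectors.\<close>

lemma chi_tau_norm: "cnj (chi tau) * chi tau = 1 - \<kappa> * \<kappa>"
proof -
  have "2 * \<i> * (cnj (chi tau) * chi tau) = 2 * \<i> * (1 - \<kappa> * \<kappa>)"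
    unfolding mult.assoc[symmetric] form_T[OF tau_T tau_T, symmetric]
    by (simp add: form_tau algebra_simps)
  then show ?thesis by (metis complex_i_not_zero mult_eq_0_iff mult_left_cancel zero_neq_numeral)
qed

lemma chi_tau_nz: "chi tau \<noteq> 0"
  using chi_tau_norm \<kappa>_sq by auto

lemma T_decomp:
  assumes "f \<in> Domain T"
  shows "\<exists>d\<in>Domain A. \<exists>c. f = d + c *\<^sub>C tau"
proof -
  \<comment> \<open>Chosen so that subtracting \<open>c *\<^sub>C tau\<close> kills
    \<open>chi\<close>; the conjugate appears because \<open>chi\<close> is antilinear.\<close>
  define c where "c = cnj (chi f / chi tau)"
  have "f - c *\<^sub>C tau \<in> Domain T"
    using assms tau_T subspace_Domain_T
    by (simp add: complex_vector.subspace_diff complex_vector.subspace_scale)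
  moreover have "chi (f - c *\<^sub>C tau) = 0"
    using assms chi_tau_nz by (simp add: chi_diff chi_scale Domain_H Hplus_scale c_def)
  ultimately have "f - c *\<^sub>C tau \<in> Domain A" by (rule T_chi_0)
  then show ?thesis by (metis diff_add_cancel)
qed

lemma form_T_tau_adj: "f \<in> Domain T \<Longrightarrow> form f tau_adj = 0"
proof -
  assume "f \<in> Domain T"
  then obtain d c where "d \<in> Domain A" "f = d + c *\<^sub>C tau"
    using T_decomp by blast
  then show ?thesis
    by (simp add: form_simps form_tau Domain_H Hplus_scale)
qed

lemma tau_adj_T: "tau_adj \<in> Domain (op_adjoint T)"
proof -
  have "(tau_adj, S tau_adj) \<in> op_adjoint T"
    unfolding op_adjoint_iff
  proof (intro allI impI)
    fix h w assume hw: "(h, w) \<in> T"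
    then have "w = S h"
      using T_facts(3) op_app_adjoint[OF dense] by blast
    then show "cinner w tau_adj = cinner h (S tau_adj)"
      using form_T_tau_adj[of h] hw by (auto simp: bform_def)
  qed
  then show ?thesis by blast
qed

section \<open>Normalisation of \<open>chi\<close> by the quasi-kernel\<close>

text \<open>The quasi-kernel is self-adjoint and extends \<open>A\<close>, so it is a restriction of
  the adjoint of \<open>A\<close>; the real part of \<open>B\<close> therefore acts on
  \<open>gp - gm\<close> as \<open>S\<close>.\<close>

lemma B_phi:
  assumes g: "g \<in> H"
  shows "B (gp - gm) g + cnj (B g (gp - gm)) = 2 * cinner (S (gp - gm)) g"
proof -
  let ?Q = "real_quasi_kernel \<Theta>"
  have sa: "op_adjoint ?Q = ?Q"
    using L by (simp add: L_system_def star_extension_def self_adjoint_def real_quasi_kernel_def)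
  have "A \<subseteq> ?Q"
  proof clarify
    fix f a assume fa: "(f, a) \<in> A"
    then have f: "f \<in> Domain A" by blast
    have "a = S f"
      using fa sym op_app_adjoint[OF dense] by blast
    have fT: "f \<in> Domain T" "f \<in> Domain (op_adjoint T)" using f T_facts(4) by auto
    have "rig_Re A B f = emb A a"
    proof
      fix h show "rig_Re A B f h = emb A a h"
        using B_T[OF fT(1), of h] B_adj_T[OF fT(2), of h] B_off[of f h] f cinner_commute[of a h]
        by (auto simp: rig_Re_def rig_adjoint_def emb_def \<open>a = S f\<close> Domain_H)
    qed
    then show "(f, a) \<in> ?Q"
      using f by (simp add: real_quasi_kernel_def quasi_kernel_def Domain_H)
  qed
  then have "?Q \<subseteq> op_adjoint A"
    using op_adjoint_antimono[of A ?Q] sa by simp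
  then have "(gp - gm, S (gp - gm)) \<in> ?Q"
    using phi op_app_adjoint[OF dense] by blast
  then have "rig_Re A B (gp - gm) g = emb A (S (gp - gm)) g"
    by (simp add: real_quasi_kernel_def quasi_kernel_def)
  then show ?thesis
    using g by (simp add: rig_Re_def rig_adjoint_def emb_def field_simps)
qed

text \<open>\<open>B_phi\<close> and \<open>B_Im\<close> express the pairing of
  \<open>B (gp - gm)\<close> with \<open>tau_adj\<close> and that of \<open>B tau\<close> with
  \<open>gp - gm\<close> through \<open>chi\<close>. The same pairings are known from the adjoint of
  \<open>T\<close> and from \<open>T\<close>, and the discrepancy is a boundary form. The equal
  values fix the phase of \<open>chi tau_adj\<close> relative to \<open>chi tau\<close>.\<close>

lemma chi_phi_tau:
  shows "cnj (chi (gp - gm)) * chi tau_adj = 2 * (1 - \<kappa>)"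
    and "cnj (chi (gp - gm)) * chi tau = 2 * (1 - \<kappa>)"
proof -
  have H: "gp - gm \<in> H" by (simp add: Hplus_diff)
  have "B (gp - gm) tau_adj = cinner (S (gp - gm)) tau_adj + \<i> * cnj (chi (gp - gm)) * chi tau_adj"
    by (rule half_sum_diff(1)[OF B_phi]) (simp_all add: B_Im[OF H] algebra_simps)
  moreover have "B (gp - gm) tau_adj = cinner (gp - gm) (S tau_adj)"
    using tau_adj_T H by (rule B_adj_T)
  ultimately have "\<i> * (cnj (chi (gp - gm)) * chi tau_adj) = - form (gp - gm) tau_adj"
    by (simp add: bform_def algebra_simps)
  then have "\<i> * (cnj (chi (gp - gm)) * chi tau_adj) = \<i> * (2 * (1 - \<kappa>))"
    by (simp add: form_tau form_diff_left algebra_simps)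
  then show "cnj (chi (gp - gm)) * chi tau_adj = 2 * (1 - \<kappa>)"
    by (metis complex_i_not_zero mult_left_cancel of_real_mult)
  have "cnj (B tau (gp - gm)) = cinner (S (gp - gm)) tau - \<i> * cnj (chi (gp - gm)) * chi tau"
    by (rule half_sum_diff(2)[OF B_phi]) (simp_all add: B_Im[OF H] algebra_simps)
  moreover have "cnj (B tau (gp - gm)) = cinner (gp - gm) (S tau)"
    using B_T[OF tau_T H] cinner_commute[of "gp - gm" "S tau"] by simp
  ultimately have "\<i> * (cnj (chi (gp - gm)) * chi tau) = form (gp - gm) tau"
    by (simp add: bform_def algebra_simps)
  then have "\<i> * (cnj (chi (gp - gm)) * chi tau) = \<i> * (2 * (1 - \<kappa>))"
    by (simp add: form_tau form_diff_left algebra_simps)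
  then show "cnj (chi (gp - gm)) * chi tau = 2 * (1 - \<kappa>)"
    by (metis complex_i_not_zero mult_left_cancel of_real_mult)
qed

lemma chi_tau_adj: "chi tau_adj = chi tau"
proof -
  have "complex_of_real (2 * (1 - \<kappa>)) \<noteq> 0"
    using \<kappa> by (metis less_irrefl mult_eq_0_iff of_real_eq_0_iff right_minus_eq zero_neq_numeral)
  then show ?thesis
    using chi_phi_tau by (metis mult_cancel_left mult_zero_left)
qed

text \<open>\<open>chi tau - chi tau_adj\<close> is both 0 and \<open>1 - \<kappa>\<close> times
  \<open>chi gp + chi gm\<close>.\<close>

lemma chi_gm: "chi gm = - chi gp"
proof -
  have 1: "chi tau = chi gp - \<kappa> * chi gm" "chi tau_adj = \<kappa> * chi gp - chi gm"
    by (simp_all add: tau_def tau_adj_def chi_diff chi_scale Hplus_scale)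
  have "(1 - complex_of_real \<kappa>) * (chi gm + chi gp) = 0"
    using chi_tau_adj 1 by (simp add: algebra_simps)
  moreover have "1 - complex_of_real \<kappa> \<noteq> 0"
    using \<kappa> by (metis less_irrefl of_real_eq_1_iff right_minus_eq)
  ultimately show ?thesis by (simp add: eq_neg_iff_add_eq_0)
qed

section \<open>Boundary coordinates on \<open>H\<close>\<close>

lemma H_decomp:
  assumes "f \<in> H"
  shows "\<exists>d\<in>Domain A. \<exists>p q. f = d + p *\<^sub>C gp + q *\<^sub>C gm"
proof -
  obtain d n1 n2 where d: "d \<in> Domain A" and n: "n1 \<in> op_ker (op_adjoint A) \<i>"
    "n2 \<in> op_ker (op_adjoint A) (- \<i>)" "f = d + n1 + n2"
    using von_Neumann_decomposition[OF lin cl sym assms] by blast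
  have dim: "complex_vector.dim (op_ker (op_adjoint A) \<i>) = 1"
      "complex_vector.dim (op_ker (op_adjoint A) (- \<i>)) = 1"
    using L by (simp_all add: L_system_def symmetric_operator_11_def)
  have "gp \<noteq> 0" "gm \<noteq> 0" using norm_g by (metis norm_zero zero_neq_one)+
  then obtain p q where "n1 = p *\<^sub>C gp" "n2 = q *\<^sub>C gm"
    using dim_1_scale[OF dim(1) gp _ n(1)] dim_1_scale[OF dim(2) gm _ n(2)] by blast
  with d n show ?thesis by blast
qed

lemma H_decomp_tau:
  assumes "f \<in> H"
  shows "\<exists>d\<in>Domain A. \<exists>p q. f = d + p *\<^sub>C tau + q *\<^sub>C tau_adj"
proof -
  obtain d p q where d: "d \<in> Domain A" "f = d + p *\<^sub>C gp + q *\<^sub>C gm"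
    using H_decomp[OF assms] by blast
  \<comment> \<open>The change of basis from \<open>gp\<close>, \<open>gm\<close> to
    \<open>tau\<close>, \<open>tau_adj\<close> has determinant
    \<open>\<kappa> * \<kappa> - 1\<close>; \<open>c\<close> is minus its inverse.\<close>
  define c where "c = 1 / (1 - complex_of_real \<kappa> * complex_of_real \<kappa>)"
  have c: "c - c * \<kappa> * \<kappa> = 1"
    using \<kappa>_sq by (simp add: c_def field_simps)
  have "(c * p + c * \<kappa> * q) *\<^sub>C tau + (- c * \<kappa> * p - c * q) *\<^sub>C tau_adj
      = ((c - c * \<kappa> * \<kappa>) * p) *\<^sub>C gp + ((c - c * \<kappa> * \<kappa>) * q) *\<^sub>C gm"
    by (simp add: tau_def tau_adj_def complex_vector.scale_right_diff_distrib
        complex_vector.scale_left_diff_distrib scaleC_add_left algebra_simps)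
  then show ?thesis
    using d unfolding c by (metis add.assoc mult_1)
qed

text \<open>Converse of \<open>form_T_tau_adj\<close>: pairing with \<open>tau_adj\<close> sees only
  the \<open>tau_adj\<close>-coordinate of \<open>f\<close>, since \<open>tau_adj\<close> is not
  isotropic for the form.\<close>

lemma form_mem_T:
  assumes "f \<in> H" "form f tau_adj = 0"
  shows "f \<in> Domain T"
proof -
  obtain d p q where d: "d \<in> Domain A" "f = d + p *\<^sub>C tau + q *\<^sub>C tau_adj"
    using H_decomp_tau[OF assms(1)] by blast
  have "form f tau_adj = q * (2 * \<i> * (\<kappa> * \<kappa> - 1))"
    using d by (simp add: form_simps form_tau Domain_H Hplus_scale Hplus_add algebra_simps)
  then have "q = 0" using assms(2) \<kappa>_sq by simp
  moreover have "d \<in> Domain T" using d T_facts(4) by blast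
  ultimately show ?thesis
    using d tau_T subspace_Domain_T
    by (simp add: complex_vector.subspace_add complex_vector.subspace_scale)
qed

text \<open>Both sides depend on \<open>f\<close> only through \<open>p - q\<close>, on the right
  because \<open>chi gm = - chi gp\<close>. This trades the output \<open>chi f\<close> for boundary
  forms.\<close>

lemma form_diff_tau:
  assumes "f \<in> H"
  shows "form f tau - form f tau_adj = 2 * \<i> * cnj (chi f) * chi tau"
proof -
  obtain d p q where d: "d \<in> Domain A" "f = d + p *\<^sub>C gp + q *\<^sub>C gm"
    using H_decomp[OF assms] by blast
  have "chi f = (cnj p - cnj q) * chi gp"
    using d by (simp add: chi_add chi_scale chi_A chi_gm Domain_H Hplus_scale Hplus_add algebra_simps)
  then have 1: "cnj (chi f) * chi tau = (p - q) * (cnj (chi gp) * chi tau)"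
    by simp
  have "cnj (chi gp) * chi tau + cnj (chi gp) * chi tau = 2 * (1 - \<kappa>)"
    using chi_phi_tau(2) by (simp add: chi_diff chi_gm algebra_simps)
  then have "cnj (chi gp) * chi tau = 1 - \<kappa>"
    using half_sum_diff(1)[of _ "cnj (chi gp) * chi tau" _ 0] by simp
  with 1 have "cnj (chi f) * chi tau = (p - q) * (1 - \<kappa>)"
    by simp
  moreover have "form f tau - form f tau_adj = 2 * \<i> * ((p - q) * (1 - \<kappa>))"
    using d by (simp add: form_simps form_tau Domain_H Hplus_scale Hplus_add algebra_simps)
  ultimately show ?thesis
    by (simp add: mult.assoc)
qed

text \<open>It suffices to test \<open>g\<close> in \<open>Domain A\<close>,
  \<open>g = tau_adj\<close> and \<open>g = tau\<close>: the first two lie in the domain of the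
  adjoint of \<open>T\<close>, and \<open>tau\<close> is reached from \<open>T\<close> through
  \<open>B_Im\<close>.\<close>

lemma B_eq:
  assumes f: "f \<in> H" and g: "g \<in> H"
  shows "B f g = cinner (S f) g - form f tau_adj / chi tau * chi g"
proof -
  obtain d p q where d: "d \<in> Domain A" "g = d + p *\<^sub>C tau + q *\<^sub>C tau_adj"
    using H_decomp_tau[OF g] by blast
  have "d \<in> Domain (op_adjoint T)" using d T_facts(4) by blast
  then have Bd: "B f d = cinner (S f) d"
    using B_adj_T[of d f] form_A_right[OF f d(1)] f by (simp add: bform_def)
  have Bta: "B f tau_adj = cinner (S f) tau_adj - form f tau_adj"
    using B_adj_T[OF tau_adj_T f] by (simp add: bform_def)
  have "cnj (B tau f) = cinner f (S tau)"
    using B_T[OF tau_T f] cinner_commute[of f "S tau"] by simp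
  then have "B f tau = cinner (S f) tau - form f tau + 2 * \<i> * cnj (chi f) * chi tau"
    using B_Im[OF f, of tau] by (simp add: bform_def algebra_simps)
  then have Bt: "B f tau = cinner (S f) tau - form f tau_adj"
    using form_diff_tau[OF f] by (simp add: algebra_simps)
  show ?thesis
    using d f chi_tau_nz
    by (simp add: B_add_right B_scale_right Bd Bt Bta chi_add chi_scale chi_A chi_tau_adj Domain_H
        Hplus_scale Hplus_add cinner_simps field_simps)
qed

section \<open>The transfer function as a quotient of boundary forms\<close>

text \<open>Testing against \<open>Domain A\<close>, where \<open>chi\<close> vanishes, gives the
  eigenvalue equation by density; testing against \<open>tau\<close>, where it does not, fixes the
  boundary value.\<close>

lemma shift_eq_iff:
  assumes f: "f \<in> H"
  shows "state_shift \<Theta> z f = chi \<longleftrightarrow>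
    f \<in> op_ker (op_adjoint A) z \<and> form f tau_adj = - chi tau"
proof
  assume *: "f \<in> op_ker (op_adjoint A) z \<and> form f tau_adj = - chi tau"
  then have "S f = z *\<^sub>C f"
    by (intro op_app_adjoint[OF dense]) (simp add: op_ker_def)
  then show "state_shift \<Theta> z f = chi"
    using * f chi_tau_nz
    by (auto simp: fun_eq_iff state_shift_def emb_def B_eq B_off chi_off cinner_simps)
next
  assume *: "state_shift \<Theta> z f = chi"
  have eq: "cinner (S f - z *\<^sub>C f) g = (1 + form f tau_adj / chi tau) * chi g" if "g \<in> H" for g
    using fun_cong[OF *, of g] that f
    by (simp add: state_shift_def emb_def B_eq cinner_simps algebra_simps)
  have "S f - z *\<^sub>C f = 0"
  proof (rule cinner_dense_eq_0)
    show "closure (Domain A) = UNIV" using dense by (simp add: densely_defined_def)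
    show "cinner g (S f - z *\<^sub>C f) = 0" if "g \<in> Domain A" for g
      using eq[of g] chi_A[OF that] that cinner_commute[of g "S f - z *\<^sub>C f"] by (simp add: Domain_H)
  qed
  moreover from this have "1 + form f tau_adj / chi tau = 0"
    using eq[of tau] chi_tau_nz by simp
  ultimately show "f \<in> op_ker (op_adjoint A) z \<and> form f tau_adj = - chi tau"
    using op_app_adjoint_mem[OF dense f] chi_tau_nz
    by (simp add: op_ker_def field_simps add_eq_0_iff)
qed

text \<open>Only a trivial kernel of \<open>T - z\<close> is assumed, because for the coupling only
  the resolvent sets of the two factors are given.\<close>

lemma transfer_function_eq:
  assumes inj: "op_ker (op_adjoint A) z \<inter> Domain T \<subseteq> {0}"
    and x: "x \<in> op_ker (op_adjoint A) z" "x \<noteq> 0"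
  shows "form x tau_adj \<noteq> 0" "transfer_function \<Theta> z = form x tau / form x tau_adj"
proof -
  have xH: "x \<in> H" using x(1) by (rule op_ker_Hplus)
  show nz: "form x tau_adj \<noteq> 0"
    using form_mem_T[OF xH] inj x by blast
  \<comment> \<open>The multiple of \<open>x\<close> with the boundary value demanded by
    \<open>shift_eq_iff\<close>.\<close>
  define y0 where "y0 = (- chi tau / form x tau_adj) *\<^sub>C x"
  have y0: "y0 \<in> op_ker (op_adjoint A) z" "y0 \<in> H"
    unfolding y0_def
    by (rule complex_vector.subspace_scale[OF subspace_op_ker_adjoint x(1)], rule Hplus_scale[OF xH])
  have f0: "form y0 tau_adj = - chi tau"
    unfolding y0_def form_scale_left[OF xH] using nz by simp
  have "state_shift \<Theta> z y0 = chi"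
    using shift_eq_iff[OF y0(2)] y0 f0 by simp
  moreover define y where "y = inv_into H (state_shift \<Theta> z) chi"
  ultimately have y: "y \<in> H" "state_shift \<Theta> z y = chi"
    using y0(2) by (metis image_eqI inv_into_into, metis image_eqI f_inv_into_f)
  then have yk: "y \<in> op_ker (op_adjoint A) z" "form y tau_adj = - chi tau"
    using shift_eq_iff by blast+
  \<comment> \<open>\<open>inv_into\<close> picks some solution \<open>y\<close>; two solutions
    differ by an element of the kernel with zero boundary value, which is thus in
    \<open>Domain T\<close> and zero.\<close>
  have "y - y0 \<in> op_ker (op_adjoint A) z"
    using yk y0 by (simp add: complex_vector.subspace_diff[OF subspace_op_ker_adjoint])
  moreover have "y - y0 \<in> Domain T"
    using y(1) y0(2) yk(2) f0 by (intro form_mem_T) (simp_all add: Hplus_diff form_diff_left)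
  ultimately have "y = y0" using inj by auto
  have "transfer_function \<Theta> z = 1 - 2 * \<i> * cnj (chi y)"
    by (simp add: transfer_function_def chan_adjoint_def chi_def[symmetric] y_def)
  also have "\<dots> = - form y tau / chi tau"
    using form_diff_tau[OF y(1)] yk(2) chi_tau_nz by (simp add: field_simps)
  also have "\<dots> = form x tau / form x tau_adj"
    unfolding \<open>y = y0\<close> y0_def form_scale_left[OF xH] using chi_tau_nz by simp
  finally show "transfer_function \<Theta> z = form x tau / form x tau_adj" .
qed

lemma resolvent_ker_T:
  assumes "z \<in> resolvent_set T"
  shows "op_ker (op_adjoint A) z \<inter> Domain T \<subseteq> {0}"
proof
  fix x assume x: "x \<in> op_ker (op_adjoint A) z \<inter> Domain T"
  then have "S x = z *\<^sub>C x"
    by (intro op_app_adjoint[OF dense]) (simp add: op_ker_def)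
  then have "(x, z *\<^sub>C x) \<in> T" using T_app[of x] x by simp
  then show "x \<in> {0}"
    using resolvent_set_op_ker[OF assms] T_facts(1) by (simp add: linear_operator_def)
qed

text \<open>Solve \<open>(T - z) t = (S - z) gm\<close>. Then \<open>gm - t\<close> is in the
  kernel, and it is nonzero because its form with \<open>tau_adj\<close> equals that of
  \<open>gm\<close>, namely \<open>2 * \<i>\<close>.\<close>

lemma deficiency_nontrivial:
  assumes "z \<in> resolvent_set T"
  shows "\<exists>u\<in>op_ker (op_adjoint A) z. u \<noteq> 0"
proof -
  obtain t where t: "(t, S gm - z *\<^sub>C gm + z *\<^sub>C t) \<in> T"
    using resolvent_set_surj[OF assms] by blast
  then have tT: "t \<in> Domain T" by blast
  have "op_app (op_adjoint A) t = S gm - z *\<^sub>C gm + z *\<^sub>C t"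
    using t T_facts(3) by (intro op_app_adjoint[OF dense]) blast
  moreover have "(gm - t, S gm - S t) \<in> op_adjoint A"
    using complex_vector.subspace_diff[OF subspace_op_adjoint op_app_adjoint_mem[OF dense g_H(2)]
        op_app_adjoint_mem[OF dense Domain_H(1)[OF tT]]] by simp
  ultimately have "gm - t \<in> op_ker (op_adjoint A) z"
    by (simp add: op_ker_def complex_vector.scale_right_diff_distrib)
  moreover have "form (gm - t) tau_adj = 2 * \<i>"
    using form_T_tau_adj[OF tT] by (simp add: form_diff_left Domain_H tT form_tau)
  then have "gm - t \<noteq> 0"
    using form_T_tau_adj[OF complex_vector.subspace_0[OF subspace_Domain_T]]
    by (metis complex_i_not_zero mult_eq_0_iff zero_neq_numeral)
  ultimately show ?thesis by blast
qed

end

section \<open>The coupling\<close>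

text \<open>Testing with \<open>(0, 0)\<close> in one summand separates the two components of the
  adjoint relation.\<close>

lemma op_adjoint_op_sum:
  fixes A1 :: "'a::complex_hilbert operator" and A2 :: "'b::complex_hilbert operator"
  assumes "(0, 0) \<in> A1" "(0, 0) \<in> A2"
  shows "op_adjoint (op_sum A1 A2) = op_sum (op_adjoint A1) (op_adjoint A2)"
proof (intro set_eqI iffI)
  fix p :: "('a \<times> 'b) \<times> ('a \<times> 'b)"
  obtain g1 g2 h1 h2 where p: "p = ((g1, g2), (h1, h2))"
    by (metis prod.collapse)
  show "p \<in> op_sum (op_adjoint A1) (op_adjoint A2)" if "p \<in> op_adjoint (op_sum A1 A2)"
  proof -
    have *: "cinner w1 g1 + cinner w2 g2 = cinner f1 h1 + cinner f2 h2"
      if "(f1, w1) \<in> A1" "(f2, w2) \<in> A2" for f1 w1 f2 w2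
    proof -
      have "((f1, f2), (w1, w2)) \<in> op_sum A1 A2" using that by (auto simp: op_sum_def)
      then show ?thesis
        using \<open>p \<in> op_adjoint (op_sum A1 A2)\<close> unfolding p op_adjoint_iff
        by (force simp: cinner_prod_def)
    qed
    have "(g1, h1) \<in> op_adjoint A1" "(g2, h2) \<in> op_adjoint A2"
      using *[OF _ assms(2)] *[OF assms(1)] by (auto simp: op_adjoint_iff)
    then show ?thesis by (auto simp: p op_sum_def)
  qed
  show "p \<in> op_adjoint (op_sum A1 A2)" if "p \<in> op_sum (op_adjoint A1) (op_adjoint A2)"
    using that by (auto simp: p op_sum_def op_adjoint_iff cinner_prod_def)
qed

lemma Domain_op_sum: "Domain (op_sum A1 A2) = Domain A1 \<times> Domain A2"
  unfolding op_sum_def set_eq_iff Domain_iff by auto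

text \<open>In terms of \<open>\<beta>\<close> the two cases in the definition of the coupling become one.\<close>

lemma coupling_anglesE:
  assumes "coupling_angles \<kappa>1 \<kappa>2 \<alpha> \<beta>" "0 \<le> \<kappa>1" "\<kappa>1 < 1" "0 \<le> \<kappa>2" "\<kappa>2 < 1"
  shows "0 < sin \<alpha>" "0 < cos \<beta>" "cos \<alpha> = \<kappa>2 * cos \<beta>" "sin \<beta> = \<kappa>1 * sin \<alpha>"
    "coupling_vector gp1 gm1 \<kappa>1 gp2 gm2 \<kappa>2 \<alpha> =
      (complex_of_real (sin \<alpha>) *\<^sub>C (gp1 - complex_of_real \<kappa>1 *\<^sub>C gm1),
       complex_of_real (cos \<beta>) *\<^sub>C (complex_of_real \<kappa>2 *\<^sub>C gp2 - gm2))"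
proof -
  have \<alpha>: "0 < \<alpha>" "\<alpha> \<le> pi / 2" using assms(1) by (auto simp: coupling_angles_def)
  then show "0 < sin \<alpha>" by (intro sin_gt_zero) auto
  have sq: "\<kappa>1\<^sup>2 < 1" "\<kappa>2\<^sup>2 < 1" using assms by (simp_all add: power_less_one_iff abs_square_less_1)
  have right: "sin \<alpha> = 1" "cos \<alpha> = 0" if "\<kappa>2 = 0"
    using assms(1) that unfolding coupling_angles_def by (metis sin_pi_half, metis cos_pi_half)
  show c: "cos \<alpha> = \<kappa>2 * cos \<beta>" and "sin \<beta> = \<kappa>1 * sin \<alpha>"
    using assms(1) by (cases "\<kappa>2 = 0"; simp add: coupling_angles_def right)+
  show "0 < cos \<beta>"
  proof (cases "\<kappa>2 = 0")
    case True
    then show ?thesis using assms(1) sq by (simp add: coupling_angles_def)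
  next
    case False
    then have "tan \<alpha> = 1 / \<kappa>2 * sqrt ((1 - \<kappa>2\<^sup>2) / (1 - \<kappa>1\<^sup>2))"
      using assms(1) by (simp add: coupling_angles_def)
    then have "tan \<alpha> \<noteq> 0" using sq False by simp
    \<comment> \<open>Division by zero makes \<open>tan\<close> vanish where \<open>cos\<close>
      does, so a nonzero tangent excludes the right angle.\<close>
    then have "cos \<alpha> \<noteq> 0" by (auto simp: tan_def)
    moreover have "0 \<le> cos \<alpha>" using \<alpha> by (intro cos_ge_zero) auto
    ultimately have "0 < \<kappa>2 * cos \<beta>" unfolding c[symmetric] by simp
    then show ?thesis using assms(4) by (simp add: zero_less_mult_iff)
  qed
  show "coupling_vector gp1 gm1 \<kappa>1 gp2 gm2 \<kappa>2 \<alpha> =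
      (complex_of_real (sin \<alpha>) *\<^sub>C (gp1 - complex_of_real \<kappa>1 *\<^sub>C gm1),
       complex_of_real (cos \<beta>) *\<^sub>C (complex_of_real \<kappa>2 *\<^sub>C gp2 - gm2))"
  proof (cases "\<kappa>2 = 0")
    case True
    then show ?thesis
      using assms(1) by (simp add: coupling_angles_def coupling_vector_def right)
  next
    case False
    then show ?thesis
      by (simp add: c coupling_vector_def complex_vector.scale_right_diff_distrib mult.commute)
  qed
qed

locale coupled_systems =
  s1: hypothesis_I_system \<Theta>1 gp1 gm1 \<kappa>1 + s2: hypothesis_I_system \<Theta>2 gp2 gm2 \<kappa>2
  for \<Theta>1 :: "'a::complex_hilbert lsystem" and gp1 gm1 :: 'a and \<kappa>1 :: real
    and \<Theta>2 :: "'b::complex_hilbert lsystem" and gp2 gm2 :: 'b and \<kappa>2 :: real +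
  fixes \<Theta> :: "('a \<times> 'b) lsystem" and \<alpha> \<beta> :: real and v Gp Gm :: "'a \<times> 'b"
  assumes angles: "coupling_angles \<kappa>1 \<kappa>2 \<alpha> \<beta>"
    and v_def: "v = coupling_vector gp1 gm1 \<kappa>1 gp2 gm2 \<kappa>2 \<alpha>"
    and Gp_def: "Gp = coupling_deficiency \<alpha> gp1 gp2"
    and Gm_def: "Gm = coupling_deficiency \<beta> gm1 gm2"
    and symm: "symm_op \<Theta> = coupling_symm_op (symm_op \<Theta>1) (symm_op \<Theta>2) v"
    and main: "main_op \<Theta> = coupling_main_op (symm_op \<Theta>1) (symm_op \<Theta>2) v
      (Gp - complex_of_real (\<kappa>1 * \<kappa>2) *\<^sub>C Gm)"
    and LS: "L_system \<Theta>"
    and phi: "Gp - Gm \<in> Domain (real_quasi_kernel \<Theta>)"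
begin

lemmas ang = coupling_anglesE(1-4)[OF angles s1.\<kappa> s2.\<kappa>]

lemma v_eq: "v = (complex_of_real (sin \<alpha>) *\<^sub>C s1.tau, complex_of_real (cos \<beta>) *\<^sub>C s2.tau_adj)"
  unfolding v_def coupling_anglesE(5)[OF angles s1.\<kappa> s2.\<kappa>] s1.tau_def s2.tau_adj_def ..

lemma cos_sin: "cos \<alpha> * cos \<alpha> + sin \<alpha> * sin \<alpha> = 1" "cos \<beta> * cos \<beta> + sin \<beta> * sin \<beta> = 1"
  using sin_cos_squared_add3[of \<alpha>] sin_cos_squared_add3[of \<beta>] by simp_all

section \<open>The adjoint of the coupled symmetric operator\<close>

lemma zero_mem: "(0, 0) \<in> symm_op \<Theta>1" "(0, 0) \<in> symm_op \<Theta>2"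
  using complex_vector.subspace_0[of "symm_op \<Theta>1"] complex_vector.subspace_0[of "symm_op \<Theta>2"]
    s1.lin s2.lin by (auto simp: linear_operator_def zero_prod_def)

lemmas adj_sum = op_adjoint_op_sum[OF zero_mem]

lemma mem_adj_sum: "((f1, f2), (h1, h2)) \<in> op_adjoint (op_sum s1.A s2.A) \<longleftrightarrow>
    (f1, h1) \<in> op_adjoint s1.A \<and> (f2, h2) \<in> op_adjoint s2.A"
  unfolding adj_sum by (auto simp: op_sum_def)

lemma op_sum_sub: "op_sum s1.A s2.A \<subseteq> symm_op \<Theta>"
proof clarify
  fix f1 f2 h1 h2 assume *: "((f1, f2), (h1, h2)) \<in> op_sum s1.A s2.A"
  then have "(f1, h1) \<in> s1.A" "(f2, h2) \<in> s2.A" by (auto simp: op_sum_def)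
  then have 1: "((f1, f2), (h1, h2)) \<in> op_adjoint (op_sum s1.A s2.A)"
    using s1.sym s2.sym by (auto simp: mem_adj_sum)
  have "0 \<in> complex_vector.span {v}" by (rule complex_vector.span_zero)
  then have "\<exists>d l. (f1, f2) = d + l \<and> d \<in> Domain (op_sum s1.A s2.A) \<and> l \<in> complex_vector.span {v}"
    using * by (metis Domain.intros add.right_neutral)
  with 1 show "((f1, f2), (h1, h2)) \<in> symm_op \<Theta>"
    unfolding symm coupling_symm_op_def op_restrict_def by blast
qed

lemma adj_sub: "op_adjoint (symm_op \<Theta>) \<subseteq> op_sum (op_adjoint s1.A) (op_adjoint s2.A)"
  using op_adjoint_antimono[OF op_sum_sub] by (simp add: adj_sum)

lemma mem_symm:
  assumes "(f, h) \<in> symm_op \<Theta>"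
  shows "\<exists>d1\<in>Domain s1.A. \<exists>d2\<in>Domain s2.A. \<exists>c. f = (d1, d2) + c *\<^sub>C v"
    "h = (s1.S (fst f), s2.S (snd f))" "fst f \<in> s1.H" "snd f \<in> s2.H"
proof -
  have 1: "(f, h) \<in> op_adjoint (op_sum s1.A s2.A)"
    and 2: "\<exists>d l. f = d + l \<and> d \<in> Domain (op_sum s1.A s2.A) \<and> l \<in> complex_vector.span {v}"
    using assms unfolding symm coupling_symm_op_def op_restrict_def by blast+
  show "\<exists>d1\<in>Domain s1.A. \<exists>d2\<in>Domain s2.A. \<exists>c. f = (d1, d2) + c *\<^sub>C v"
    using 2 unfolding Domain_op_sum complex_vector.span_singleton by blast
  have a: "(fst f, fst h) \<in> op_adjoint s1.A" "(snd f, snd h) \<in> op_adjoint s2.A"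
    using 1 mem_adj_sum[of "fst f" "snd f" "fst h" "snd h"] by simp_all
  then show "h = (s1.S (fst f), s2.S (snd f))"
    by (simp add: op_app_adjoint[OF s1.dense] op_app_adjoint[OF s2.dense])
  show "fst f \<in> s1.H" "snd f \<in> s2.H"
    using a by (auto intro: HplusI)
qed

lemma v_H: "fst v \<in> s1.H" "snd v \<in> s2.H"
  by (simp_all add: v_eq Hplus_scale)

text \<open>Enlarging the orthogonal sum by the single direction \<open>v\<close> cuts its adjoint
  down by one boundary condition: the summed boundary form with \<open>v\<close> must
  vanish.\<close>

lemma adj_symm_iff:
  "((x1, x2), (h1, h2)) \<in> op_adjoint (symm_op \<Theta>) \<longleftrightarrow>
     (x1, h1) \<in> op_adjoint s1.A \<and> (x2, h2) \<in> op_adjoint s2.A \<and>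
     s1.form x1 (fst v) + s2.form x2 (snd v) = 0" (is "?l \<longleftrightarrow> ?r")
proof
  assume ?r
  then have x: "(x1, h1) \<in> op_adjoint s1.A" "(x2, h2) \<in> op_adjoint s2.A" 
    and 0: "s1.form x1 (fst v) + s2.form x2 (snd v) = 0" by auto
  have H: "x1 \<in> s1.H" "x2 \<in> s2.H" using x by (auto intro: HplusI)
  have S: "s1.S x1 = h1" "s2.S x2 = h2"
    using x by (simp_all add: op_app_adjoint[OF s1.dense] op_app_adjoint[OF s2.dense])
  show ?l
    unfolding op_adjoint_iff
  proof (intro allI impI)
    fix f w assume fw: "(f, w) \<in> symm_op \<Theta>"
    obtain d1 d2 c where d: "d1 \<in> Domain s1.A" "d2 \<in> Domain s2.A" "f = (d1, d2) + c *\<^sub>C v"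
      using mem_symm(1)[OF fw] by blast
    have v0: "s1.form (fst v) x1 + s2.form (snd v) x2 = 0"
      using 0 bform_commute[of s1.A "fst v" x1] bform_commute[of s2.A "snd v" x2]
      by (metis complex_cnj_add complex_cnj_zero minus_add_distrib minus_zero)
    have "s1.form (fst f) x1 + s2.form (snd f) x2 = c * (s1.form (fst v) x1 + s2.form (snd v) x2)"
      using d H v_H by (simp add: scaleC_prod_def s1.form_simps s2.form_simps s1.Domain_H s2.Domain_H
          Hplus_scale algebra_simps)
    then have "s1.form (fst f) x1 + s2.form (snd f) x2 = 0"
      by (simp add: v0)
    then show "cinner w (x1, x2) = cinner f (h1, h2)"
      unfolding mem_symm(2)[OF fw]
      by (simp add: cinner_prod_def bform_def S algebra_simps)
  qed
next
  assume l: ?l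
  then have x: "(x1, h1) \<in> op_adjoint s1.A" "(x2, h2) \<in> op_adjoint s2.A"
    using adj_sub by (auto simp: op_sum_def)
  have S: "s1.S x1 = h1" "s2.S x2 = h2"
    using x by (simp_all add: op_app_adjoint[OF s1.dense] op_app_adjoint[OF s2.dense])
  have "((fst v, snd v), (s1.S (fst v), s2.S (snd v))) \<in> op_adjoint (op_sum s1.A s2.A)"
    unfolding mem_adj_sum using v_H op_app_adjoint_mem[OF s1.dense] op_app_adjoint_mem[OF s2.dense]
    by blast
  moreover have "\<exists>d l. (fst v, snd v) = d + l \<and> d \<in> Domain (op_sum s1.A s2.A) \<and> l \<in> complex_vector.span {v}"
  proof (intro exI conjI)
    show "(fst v, snd v) = 0 + v" by simp
    show "0 \<in> Domain (op_sum s1.A s2.A)" using zero_mem by (auto simp: Domain_op_sum zero_prod_def)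
    show "v \<in> complex_vector.span {v}" by (simp add: complex_vector.span_base)
  qed
  ultimately have "(v, (s1.S (fst v), s2.S (snd v))) \<in> symm_op \<Theta>"
    unfolding symm coupling_symm_op_def op_restrict_def by auto
  then have "cinner (s1.S (fst v), s2.S (snd v)) (x1, x2) = cinner v (h1, h2)"
    using l unfolding op_adjoint_iff by blast
  then have "s1.form (fst v) x1 + s2.form (snd v) x2 = 0"
    by (simp add: cinner_prod_def bform_def S algebra_simps)
  then have "s1.form x1 (fst v) + s2.form x2 (snd v) = 0"
    using bform_commute[of s1.A x1 "fst v"] bform_commute[of s2.A x2 "snd v"]
    by (metis complex_cnj_add complex_cnj_zero minus_add_distrib minus_zero)
  with x show ?r by blast
qed

lemma form_v: "s1.form x1 (fst v) + s2.form x2 (snd v) =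
    sin \<alpha> * s1.form x1 s1.tau + cos \<beta> * s2.form x2 s2.tau_adj"
  by (simp add: v_eq s1.form_scale_right s2.form_scale_right)

section \<open>Hypothesis I for the coupling\<close>

text \<open>The boundary condition reduces to \<open>cos \<alpha> = \<kappa>2 * cos \<beta>\<close>;
  for \<open>Gm\<close> below it reduces to
  \<open>sin \<beta> = \<kappa>1 * sin \<alpha>\<close>.\<close>

lemma Gp_ker: "Gp \<in> op_ker (op_adjoint (symm_op \<Theta>)) \<i>"
proof -
  have k: "(gp1, \<i> *\<^sub>C gp1) \<in> op_adjoint s1.A" "(gp2, \<i> *\<^sub>C gp2) \<in> op_adjoint s2.A"
    using s1.gp s2.gp by (auto simp: op_ker_def)
  show ?thesis
    using op_adjoint_scale[OF k(1), of "cos \<alpha>"] op_adjoint_scale[OF k(2), of "- complex_of_real (sin \<alpha>)"] ang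
    by (simp add: op_ker_def Gp_def coupling_deficiency_def scaleC_prod_def adj_symm_iff v_eq
        s1.form_scale_left s2.form_scale_left s1.form_scale_right s2.form_scale_right s1.form_tau s2.form_tau mult.commute
        flip: complex_vector.scale_minus_left)
qed

lemma Gm_ker: "Gm \<in> op_ker (op_adjoint (symm_op \<Theta>)) (- \<i>)"
proof -
  have k: "(gm1, (- \<i>) *\<^sub>C gm1) \<in> op_adjoint s1.A" "(gm2, (- \<i>) *\<^sub>C gm2) \<in> op_adjoint s2.A"
    using s1.gm s2.gm by (auto simp: op_ker_def)
  show ?thesis
    using op_adjoint_scale[OF k(1), of "cos \<beta>"] op_adjoint_scale[OF k(2), of "- complex_of_real (sin \<beta>)"] ang
    by (simp add: op_ker_def Gm_def coupling_deficiency_def scaleC_prod_def adj_symm_iff v_eq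
        s1.form_scale_left s2.form_scale_left s1.form_scale_right s2.form_scale_right s1.form_tau s2.form_tau mult.commute
        flip: complex_vector.scale_minus_left)
qed

lemma norm_coupling_deficiency:
  assumes "norm g1 = 1" "norm g2 = 1"
  shows "norm (coupling_deficiency t g1 g2) = 1"
  using assms by (simp add: coupling_deficiency_def norm_prod_def norm_scaleC)

text \<open>Since \<open>\<kappa>2 * cos \<beta> = cos \<alpha>\<close>, the first component is a
  multiple of \<open>s1.tau\<close>; this puts first components of the coupled domain into
  \<open>Domain s1.T\<close>.\<close>

lemma w_fst: "fst (Gp - complex_of_real (\<kappa>1 * \<kappa>2) *\<^sub>C Gm) = complex_of_real (cos \<alpha>) *\<^sub>C s1.tau"
  by (simp add: Gp_def Gm_def coupling_deficiency_def scaleC_prod_def s1.tau_def ang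
      complex_vector.scale_right_diff_distrib mult.commute mult.left_commute)

text \<open>Makes every result on a single system available for the coupling, with
  \<open>Gp\<close>, \<open>Gm\<close> and parameter \<open>\<kappa>1 * \<kappa>2\<close>.\<close>

lemma coupling_hypothesis_I: "hypothesis_I_system \<Theta> Gp Gm (\<kappa>1 * \<kappa>2)"
proof
  let ?w = "Gp - complex_of_real (\<kappa>1 * \<kappa>2) *\<^sub>C Gm"
  have "?w \<in> Hplus (symm_op \<Theta>)"
    using Gp_ker Gm_ker by (intro Hplus_diff Hplus_scale op_ker_Hplus)
  then have w: "?w \<in> Domain (op_adjoint (op_sum s1.A s2.A))"
    using op_adjoint_antimono[OF op_sum_sub] by (auto simp: Hplus_def)
  have "\<exists>d l. ?w = d + l \<and> d \<in> Domain (coupling_symm_op s1.A s2.A v) \<and> l \<in> complex_vector.span {?w}"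
  proof (intro exI conjI)
    show "?w = 0 + ?w" by simp
    have "(0, 0) \<in> symm_op \<Theta>"
      using op_sum_sub zero_mem by (force simp: op_sum_def zero_prod_def)
    then show "0 \<in> Domain (coupling_symm_op s1.A s2.A v)" unfolding symm by blast
    show "?w \<in> complex_vector.span {?w}" by (simp add: complex_vector.span_base)
  qed
  then have "?w \<in> Domain (main_op \<Theta>)"
    using w unfolding main coupling_main_op_def op_restrict_def by blast
  moreover have "\<kappa>1 * \<kappa>2 < 1"
    using s1.\<kappa> s2.\<kappa> mult_strict_mono[of \<kappa>1 1 \<kappa>2 1] by simp
  ultimately show "hypothesis_I \<Theta> Gp Gm (\<kappa>1 * \<kappa>2)"
    using Gp_ker Gm_ker phi s1.\<kappa> s2.\<kappa>
    by (simp add: hypothesis_I_def Gp_def Gm_def norm_coupling_deficiency)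
qed (rule LS)

interpretation s: hypothesis_I_system \<Theta> Gp Gm "\<kappa>1 * \<kappa>2" by (rule coupling_hypothesis_I)

section \<open>The product formula\<close>

lemma op_ker_coupling:
  "(x1, x2) \<in> op_ker (op_adjoint s.A) z \<longleftrightarrow>
     x1 \<in> op_ker (op_adjoint s1.A) z \<and> x2 \<in> op_ker (op_adjoint s2.A) z \<and>
     sin \<alpha> * s1.form x1 s1.tau + cos \<beta> * s2.form x2 s2.tau_adj = 0"
  by (simp add: op_ker_def scaleC_prod_def adj_symm_iff form_v)

lemma form_coupling:
  assumes "x \<in> s.H" "y \<in> s.H"
  shows "s.form x y = s1.form (fst x) (fst y) + s2.form (snd x) (snd y)"
proof -
  have "s.S u = (s1.S (fst u), s2.S (snd u))" if "u \<in> s.H" for u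
  proof -
    have "(u, s.S u) \<in> op_sum (op_adjoint s1.A) (op_adjoint s2.A)"
      using op_app_adjoint_mem[OF s.dense that] adj_sub by blast
    then show ?thesis
      by (auto simp: op_sum_def op_app_adjoint[OF s1.dense] op_app_adjoint[OF s2.dense])
  qed
  then show ?thesis using assms by (simp add: bform_def cinner_prod_def)
qed

lemma Domain_T_fst:
  assumes "(x1, x2) \<in> Domain s.T"
  shows "x1 \<in> Domain s1.T"
proof -
  let ?w = "Gp - complex_of_real (\<kappa>1 * \<kappa>2) *\<^sub>C Gm"
  obtain d b where d: "d \<in> Domain s.A" "(x1, x2) = d + b *\<^sub>C ?w"
    using assms unfolding main coupling_main_op_def op_restrict_def symm complex_vector.span_singleton
    by blast
  then obtain d1 d2 c where 1: "d1 \<in> Domain s1.A" "d = (d1, d2) + c *\<^sub>C v"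
    using mem_symm(1) by blast
  have "x1 = fst d + b *\<^sub>C fst ?w"
    using d(2) by (metis fst_add fst_conv scaleC_prod_def)
  also have "fst d = d1 + (c * sin \<alpha>) *\<^sub>C s1.tau"
    by (simp add: 1(2) v_eq scaleC_prod_def)
  finally have "x1 = d1 + (c * sin \<alpha>) *\<^sub>C s1.tau + (b * cos \<alpha>) *\<^sub>C s1.tau"
    unfolding w_fst by simp
  moreover have "d1 \<in> Domain s1.T" using 1 s1.T_facts(4) by blast
  ultimately show ?thesis
    using s1.tau_T s1.subspace_Domain_T
    by (simp add: complex_vector.subspace_add complex_vector.subspace_scale)
qed

text \<open>The coupling is triangular: the first component lies in \<open>Domain s1.T\<close> and
  vanishes; the boundary condition then puts the second into \<open>Domain s2.T\<close>, where it
  vanishes too.\<close>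

lemma op_ker_coupling_T:
  assumes "z \<in> resolvent_set s1.T" "z \<in> resolvent_set s2.T"
  shows "op_ker (op_adjoint s.A) z \<inter> Domain s.T \<subseteq> {0}"
proof
  fix x assume x: "x \<in> op_ker (op_adjoint s.A) z \<inter> Domain s.T"
  obtain x1 x2 where xx: "x = (x1, x2)" by (cases x)
  have k: "x1 \<in> op_ker (op_adjoint s1.A) z" "x2 \<in> op_ker (op_adjoint s2.A) z"
     "sin \<alpha> * s1.form x1 s1.tau + cos \<beta> * s2.form x2 s2.tau_adj = 0"
    using x by (auto simp: xx op_ker_coupling)
  have "x1 \<in> Domain s1.T" using x Domain_T_fst by (auto simp: xx)
  then have x1: "x1 = 0" using s1.resolvent_ker_T[OF assms(1)] k(1) by blast
  have "s1.form 0 s1.tau = 0"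
    using s1.form_scale_left[of gp1 0 s1.tau] by simp
  then have "s2.form x2 s2.tau_adj = 0" using k(3) x1 ang(2) by simp
  then have "x2 \<in> Domain s2.T" using s2.form_mem_T k(2) op_ker_Hplus by blast
  then have "x2 = 0" using s2.resolvent_ker_T[OF assms(2)] k(2) by blast
  then show "x \<in> {0}" using x1 by (simp add: xx zero_prod_def)
qed

lemma transfer_function_coupling:
  assumes z: "z \<in> resolvent_set s1.T" "z \<in> resolvent_set s2.T"
  shows "transfer_function \<Theta> z = transfer_function \<Theta>1 z * transfer_function \<Theta>2 z"
proof -
  obtain u1 where u1: "u1 \<in> op_ker (op_adjoint s1.A) z" "u1 \<noteq> 0"
    using s1.deficiency_nontrivial[OF z(1)] by blast
  obtain u2 where u2: "u2 \<in> op_ker (op_adjoint s2.A) z" "u2 \<noteq> 0"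
    using s2.deficiency_nontrivial[OF z(2)] by blast
  have uH: "u1 \<in> s1.H" "u2 \<in> s2.H" using u1 u2 by (auto intro: op_ker_Hplus)
  note W1 = s1.transfer_function_eq[OF s1.resolvent_ker_T[OF z(1)] u1]
  note W2 = s2.transfer_function_eq[OF s2.resolvent_ker_T[OF z(2)] u2]
  define P1 M1 P2 M2 where "P1 = s1.form u1 gp1" and "M1 = s1.form u1 gm1"
    and "P2 = s2.form u2 gp2" and "M2 = s2.form u2 gm2"
  define N1 D1 N2 D2 where "N1 = s1.form u1 s1.tau" and "D1 = s1.form u1 s1.tau_adj"
    and "N2 = s2.form u2 s2.tau" and "D2 = s2.form u2 s2.tau_adj"
  have ND: "N1 = P1 - \<kappa>1 * M1" "D1 = \<kappa>1 * P1 - M1" "N2 = P2 - \<kappa>2 * M2" "D2 = \<kappa>2 * P2 - M2"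
    by (simp_all add: N1_def D1_def N2_def D2_def P1_def M1_def P2_def M2_def s1.form_tau s2.form_tau)
  \<comment> \<open>Up to a common factor the solution of the boundary condition
    \<open>sin \<alpha> * c1 * N1 + cos \<beta> * c2 * D2 = 0\<close>.\<close>
  define c1 c2 where "c1 = cos \<beta> * D2" and "c2 = - (sin \<alpha> * N1)"
  define x where "x = (c1 *\<^sub>C u1, c2 *\<^sub>C u2)"
  have xk: "x \<in> op_ker (op_adjoint s.A) z"
    unfolding x_def op_ker_coupling s1.form_scale_left[OF uH(1)] s2.form_scale_left[OF uH(2)]
    using complex_vector.subspace_scale[OF subspace_op_ker_adjoint u1(1), of c1]
      complex_vector.subspace_scale[OF subspace_op_ker_adjoint u2(1), of c2]
    by (simp add: N1_def[symmetric] D2_def[symmetric]) (simp add: c1_def c2_def)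
  have "c1 \<noteq> 0" using ang(2) W2(1) by (simp add: c1_def D2_def)
  then have "x \<noteq> 0" using u1(2) by (simp add: x_def zero_prod_def)
  note W = s.transfer_function_eq[OF op_ker_coupling_T[OF z] xk this]
  have xH: "x \<in> s.H" using xk by (rule op_ker_Hplus)
  have formG: "s.form x Gp = cos \<alpha> * c1 * P1 - sin \<alpha> * c2 * P2"
    "s.form x Gm = cos \<beta> * c1 * M1 - sin \<beta> * c2 * M2"
    unfolding form_coupling[OF xH s.g_H(1)] form_coupling[OF xH s.g_H(2)]
    using uH by (simp_all add: x_def Gp_def Gm_def coupling_deficiency_def
        s1.form_scale_left s2.form_scale_left s1.form_scale_right s2.form_scale_right
        P1_def M1_def P2_def M2_def algebra_simps flip: complex_vector.scale_minus_left)
  have "complex_of_real (cos \<alpha> * cos \<alpha> + sin \<alpha> * sin \<alpha>) = 1"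
     "complex_of_real (cos \<beta> * cos \<beta> + sin \<beta> * sin \<beta>) = 1"
    unfolding cos_sin by simp_all
  \<comment> \<open>The Pythagorean identities for \<alpha> and \<beta>, with
    \<open>cos \<alpha>\<close> and \<open>sin \<beta>\<close> eliminated.\<close>
  then have cs: "\<kappa>2 * \<kappa>2 * complex_of_real (cos \<beta>) * cos \<beta> + complex_of_real (sin \<alpha>) * sin \<alpha> = 1"
    "complex_of_real (cos \<beta>) * cos \<beta> + \<kappa>1 * \<kappa>1 * complex_of_real (sin \<alpha>) * sin \<alpha> = 1"
    by (simp_all add: ang algebra_simps)
  \<comment> \<open>Here \<open>N1\<close> factors out, and \<open>cs\<close> makes the remaining
    coefficients of \<open>P2\<close> and \<open>M2\<close> equal to 1 and
    \<open>- \<kappa>2\<close>. In the denominator \<open>D2\<close> factors out and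
    \<open>cs\<close> leaves \<open>D1\<close>.\<close>
  have num: "s.form x s.tau = N1 * N2"
    unfolding s.form_tau formG c1_def c2_def ND ang of_real_mult using cs[unfolded of_real_mult] by algebra
  have den: "s.form x s.tau_adj = D1 * D2"
    unfolding s.form_tau formG c1_def c2_def ND ang of_real_mult using cs[unfolded of_real_mult] by algebra
  show ?thesis
    unfolding W(2) W1(2) W2(2) num den by (simp add: N1_def D1_def N2_def D2_def)
qed

end

theorem theorem6p4:
  fixes \<Theta>1 :: "'a::complex_hilbert lsystem"
    and \<Theta>2 :: "'b::complex_hilbert lsystem"
    and \<Theta> :: "('a \<times> 'b) lsystem"
    and gp1 gm1 :: 'a and gp2 gm2 :: 'b
    and \<kappa>1 \<kappa>2 :: real
    and z :: complex
  assumes "L_system \<Theta>1" and "minimal_lsystem \<Theta>1"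
    and "L_system \<Theta>2" and "minimal_lsystem \<Theta>2"
    and "hypothesis_I \<Theta>1 gp1 gm1 \<kappa>1"
    and "hypothesis_I \<Theta>2 gp2 gm2 \<kappa>2"
    and "is_coupling \<Theta>1 gp1 gm1 \<kappa>1 \<Theta>2 gp2 gm2 \<kappa>2 \<Theta>"
    and "z \<in> resolvent_set (main_op \<Theta>1) \<inter> resolvent_set (main_op \<Theta>2)"
  shows "transfer_function \<Theta> z = transfer_function \<Theta>1 z * transfer_function \<Theta>2 z"
proof -
  obtain \<alpha> \<beta> where "coupled_systems \<Theta>1 gp1 gm1 \<kappa>1 \<Theta>2 gp2 gm2 \<kappa>2 \<Theta> \<alpha> \<beta>
      (coupling_vector gp1 gm1 \<kappa>1 gp2 gm2 \<kappa>2 \<alpha>)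
      (coupling_deficiency \<alpha> gp1 gp2) (coupling_deficiency \<beta> gm1 gm2)"
    using assms(1,3,5-7)
    unfolding is_coupling_def Let_def coupled_systems_def coupled_systems_axioms_def
      hypothesis_I_system_def
    by blast
  then show ?thesis
    using assms(8) by (simp add: coupled_systems.transfer_function_coupling)
qed

end
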